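(* Let $p\in(d,\infty)$. There exists a constant $S_\infty(\Omega,\eta)>0$, depending only on $\Omega$ and $\eta$, such that the following holds. Assume: (i) for some $K\le S_\infty(\Omega,\eta)$ (with $K>0$) there is a sequence of Borel maps $T_n:\Omega\to V_n$ with $T_n\#\mu=\mu_n$ and $\sup_{x\in\Omega}|T_n(x)-x|\le K\varepsilon_n$ for every $n\in\mathbb N$; (ii) $\eta$ is continuous at $0$, non-increasing, and $\eta(0)>0$; (iii) there is $D>0$ with $\frac1D\le\rho(x)\le D$ for all $x\in\Omega$. Additionally assume there exists $t>p$ such that $\aleph_\eta^t<+\infty$, and $$\frac{\varepsilon_n^p\Lambda_n^+}{(\Lambda_n^-)^2}\to0\quad\text{as }n\to\infty.$$ Let $(u_n)_{n\in\mathbb N}$ be a sequence of functions $u_n:V_n\to\mathbb R$ such that $\{\|u_n\|_{L^p(V_n;\mu_n)}\}_{n\in\mathbb N}$ and $\{\mathcal{GE}_n^p(u_n)\}_{n\in\mathbb N}$ are bounded. Then, after possibly passing to a subsequence, there exists $u\in C^{0,1-\frac dp}(\overline\Omega)$ such that, with $T_n$ the maps from (i), $$\sup_{x\in\Omega}|u_n\circ T_n(x)-u(x)|\to0\quad\text{as }n\to\infty.$$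
   Context: $\mathbb N=\{1,2,\dots\}$; $d\in\mathbb N$; $\Omega\subset\mathbb R^d$ is open and bounded with Lipschitz boundary (near each boundary point, in suitable orthonormal coordinates, $\Omega$ is the region on one side of the graph of a Lipschitz function). $\mu$ is a probability measure on $\Omega$ with continuous density $\rho:\Omega\to\mathbb R$ with respect to Lebesgue measure. For $n\in\mathbb N$, $V_n\subset\Omega$ is a finite set, $\mu_n$ is a probability measure on $V_n$ (also regarded as a measure on $\Omega$), $\mu_n(x):=\mu_n(\{x\})$, $\Lambda_n^-:=\min_{x\in V_n}\mu_n(x)$, $\Lambda_n^+:=\max_{x\in V_n}\mu_n(x)$. $(\varepsilon_n)_{n\in\mathbb N}$ is a sequence of positive reals with $\varepsilon_n\to0$. The kernel is a function $\eta:[0,\infty)\to[0,\infty)$, and $\eta_\varepsilon(r):=\varepsilon^{-d}\eta(r/\varepsilon)$ for $\varepsilon>0$. For $t\ge0$, $\aleph_\eta^t:=\int_0^\infty\eta(r)r^{d+t-1}\,dr$. The push-forward is $T\#\mu(A):=\mu(T^{-1}(A))$. $C^{0,\gamma}(\overline\Omega)$ denotes the space of $\gamma$-Hölder continuous functions on $\overline\Omega$. For $u:V_n\to\mathbb R$ and $p\ge1$, $$\|u\|_{L^p(V_n;\mu_n)}:=\Big(\sum_{x\in V_n}|u(x)|^p\mu_n(x)\Big)^{1/p},\qquad \mathcal{GE}_n^p(u):=\frac1{\varepsilon_n^p}\sum_{x\in V_n}\sum_{y\in V_n}\eta_{\varepsilon_n}(|x-y|)|u(x)-u(y)|^p\mu_n(x)\mu_n(y).$$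 *)

theory Defs
  imports "HOL-Probability.Probability"
begin

text \<open>
  Euclidean space of dimension \<open>d\<close> is \<^typ>\<open>real ^ 'd\<close>, so that \<open>d = CARD('d)\<close>.
\<close>

text \<open>
  A system of orthonormal coordinates enters only through its vertical unit vector \<open>e\<close>;
  the horizontal coordinates of \<open>x\<close> are represented by the projection of \<open>x\<close>
  onto the hyperplane orthogonal to \<open>e\<close>. Replacing \<open>e\<close> by \<open>- e\<close> exchanges the two sides
  of the graph.
\<close>
definition lipschitz_boundary :: "(real ^ 'd) set \<Rightarrow> bool" where
  "lipschitz_boundary \<Omega> \<longleftrightarrow>
     (\<forall>z\<in>frontier \<Omega>. \<exists>e g L r. norm e = 1 \<and> 0 < r \<and>
        L-lipschitz_on {y. y \<bullet> e = 0} g \<and>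
        \<Omega> \<inter> ball z r = {x \<in> ball z r. g (x - (x \<bullet> e) *\<^sub>R e) < x \<bullet> e})"

text \<open>Only the values of \<open>u\<close> on \<open>S\<close> matter.\<close>
definition holder_space :: "real \<Rightarrow> ('a :: metric_space) set \<Rightarrow> ('a \<Rightarrow> real) set" where
  "holder_space \<gamma> S =
     {u. \<exists>C. \<forall>x\<in>S. \<forall>y\<in>S. \<bar>u x - u y\<bar> \<le> C * dist x y powr \<gamma>}"

definition scaled_kernel :: "nat \<Rightarrow> (real \<Rightarrow> real) \<Rightarrow> real \<Rightarrow> real \<Rightarrow> real" where
  "scaled_kernel d \<eta> \<epsilon> r = \<eta> (r / \<epsilon>) / \<epsilon> ^ d"

text \<open>Valued in the extended nonnegative reals, so that finiteness is a genuine condition.\<close>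
definition kernel_moment :: "nat \<Rightarrow> (real \<Rightarrow> real) \<Rightarrow> real \<Rightarrow> ennreal" where
  "kernel_moment d \<eta> t =
     (\<integral>\<^sup>+ r\<in>{0..}. ennreal (\<eta> r * r powr (real d + t - 1)) \<partial>lborel)"

definition min_mass :: "'a set \<Rightarrow> 'a measure \<Rightarrow> real" where
  "min_mass V \<nu> = Min ((\<lambda>x. measure \<nu> {x}) ` V)"

definition max_mass :: "'a set \<Rightarrow> 'a measure \<Rightarrow> real" where
  "max_mass V \<nu> = Max ((\<lambda>x. measure \<nu> {x}) ` V)"

definition graph_Lp_norm :: "real \<Rightarrow> 'a set \<Rightarrow> 'a measure \<Rightarrow> ('a \<Rightarrow> real) \<Rightarrow> real" where
  "graph_Lp_norm p V \<nu> u = (\<Sum>x\<in>V. \<bar>u x\<bar> powr p * measure \<nu> {x}) powr (1 / p)"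

definition graph_energy ::
  "(real \<Rightarrow> real) \<Rightarrow> real \<Rightarrow> real \<Rightarrow> (real ^ 'd) set \<Rightarrow> (real ^ 'd) measure \<Rightarrow>
   (real ^ 'd \<Rightarrow> real) \<Rightarrow> real" where
  "graph_energy \<eta> p \<epsilon> V \<nu> u =
     1 / \<epsilon> powr p *
     (\<Sum>x\<in>V. \<Sum>y\<in>V. scaled_kernel CARD('d) \<eta> \<epsilon> (norm (x - y)) *
        \<bar>u x - u y\<bar> powr p * measure \<nu> {x} * measure \<nu> {y})"

text \<open>
  The ratio \<open>\<epsilon>\<^sup>p \<Lambda>\<^sup>+ / (\<Lambda>\<^sup>-)\<^sup>2\<close> is taken in the extended nonnegative reals: it is infinite when
  \<open>\<Lambda>\<^sup>- = 0\<close>, whereas division by zero in the reals would give \<open>0\<close> and make a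
  smallness condition on the ratio hold vacuously.
\<close>
definition mass_ratio ::
  "real \<Rightarrow> real \<Rightarrow> 'a set \<Rightarrow> 'a measure \<Rightarrow> ennreal" where
  "mass_ratio p \<epsilon> V \<nu> =
     ennreal (\<epsilon> powr p * max_mass V \<nu>) / ennreal ((min_mass V \<nu>)\<^sup>2)"

end

theory Submission
  imports Defs "HOL-Complex_Analysis.Great_Picard"
begin

text \<open>
  Write \<open>f\<^sub>n\<close> for \<open>u\<^sub>n \<circ> T\<^sub>n\<close>, \<open>d\<close> for the dimension and \<open>\<gamma> = 1 - d / p\<close>. Choose \<open>c > 0\<close> with \<open>\<eta> c > 0\<close>; this is
  possible as \<open>\<eta>\<close> is continuous at \<open>0\<close> with \<open>\<eta> 0 > 0\<close>. The constant of the theorem is \<open>c / 4\<close>. If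
  \<open>K \<le> c / 4\<close>, then \<open>T\<^sub>n\<close> moves points so little that all pairs of points of \<open>\<Omega>\<close> at distance at most
  \<open>h\<^sub>n = c \<epsilon>\<^sub>n / 4\<close> are seen by the kernel. The bound on the graph energies becomes a bound, uniform in
  \<open>n\<close>, on the nonlocal energies of \<open>f\<^sub>n\<close>, that is, on the integrals of \<open>\<bar>f\<^sub>n y - f\<^sub>n z\<bar> powr p\<close> over these pairs,
  divided by \<open>h\<^sub>n powr (p + d)\<close>. This is a discrete \<open>W\<^sup>1\<^sup>,\<^sup>p\<close> bound, and as \<open>p > d\<close> the classical proof of
  Morrey's inequality works at all scales above \<open>h\<^sub>n\<close>.

  On a convex set of diameter comparable to \<open>r \<ge> h\<^sub>n\<close>, cutting segments into about \<open>r / h\<^sub>n\<close> steps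
  (\<open>nonlocal_poincare\<close>) shows that averages over subsets of substantial volume differ by \<open>O(r powr \<gamma>)\<close>. Since a
  Lipschitz domain has a uniform cone property (\<open>lipschitz_boundary_uniform_cone\<close>), one may take as convex sets
  cones inside \<open>\<Omega>\<close> with vertex \<open>x\<close> and sum a geometric series over cones of halved sizes, down to size
  \<open>h\<^sub>n\<close>. Cones at two points \<open>x\<close> and \<open>y\<close> are linked by a ball of radius comparable to \<open>dist x y\<close> in both of them.

  It remains to compare \<open>f\<^sub>n x\<close> with an average of \<open>f\<^sub>n\<close> at scale \<open>h\<^sub>n\<close> around \<open>x\<close>. The contribution of the single
  vertex \<open>T\<^sub>n x\<close> to the energy, whose mass is at least the least mass \<open>\<Lambda>\<^sub>n\<close>, bounds the difference to the power
  \<open>p\<close> by a constant times \<open>\<epsilon>\<^sub>n powr p / \<Lambda>\<^sub>n\<close>. This is at most the mass ratio, so it tends to \<open>0\<close>. Altogether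
  \<open>\<bar>f\<^sub>n x - f\<^sub>n y\<bar> \<le> L * dist x y powr \<gamma> + \<delta>\<^sub>n\<close> with \<open>\<delta>\<^sub>n\<close> tending to \<open>0\<close> (\<open>nonlocal_morrey\<close>). Such functions are
  uniformly close to functions that are Hoelder continuous with a common constant, and the theorem of
  Arzela and Ascoli yields the subsequence and its limit (\<open>quasi_holder_subsequence\<close>).
\<close>

section \<open>Power means and differences of averages\<close>

text \<open>
  An additive substitute for the power-mean inequality: integrated or summed, with \<open>M\<close> equal to the
  \<open>L\<^sup>p\<close> mean of the argument, it bounds the \<open>L\<^sup>1\<close> mean by \<open>2 M\<close>. If \<open>t > M\<close>, the second summand alone is
  at least \<open>t\<close>.
\<close>

lemma le_add_powr_div_powr:
  fixes t M p :: real
  assumes "0 \<le> t" "0 < M" "1 \<le> p"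
  shows "t \<le> M + t powr p / M powr (p - 1)"
proof (cases "t \<le> M")
  case False
  then have "M powr (p - 1) \<le> t powr (p - 1)"
    using assms by (intro powr_mono2) auto
  then have "t * M powr (p - 1) \<le> t * t powr (p - 1)"
    using assms by (intro mult_left_mono) auto
  also have "\<dots> = t powr p"
    using powr_add[of t 1 "p - 1"] assms False by simp
  finally have "t \<le> t powr p / M powr (p - 1)"
    using assms by (simp add: pos_le_divide_eq)
  then show ?thesis
    using assms by simp
qed (use assms in \<open>auto intro: add_increasing2\<close>)

lemma powr_div_powr_pred:
  fixes M p :: real
  assumes "0 < M"
  shows "M powr p / M powr (p - 1) = M"
  using assms powr_diff[of M p "p - 1"] by simp

text \<open>
  What matters is the factor \<open>N powr (p - 1)\<close>, one power of \<open>N\<close> below the bound by the largest summand: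
  a path of \<open>N\<close> short steps then costs no more energy than its length allows.
\<close>

lemma powr_sum_le:
  fixes a :: "nat \<Rightarrow> real"
  assumes a: "\<And>i. i < N \<Longrightarrow> 0 \<le> a i" and N: "0 < N" and p: "1 \<le> p"
  shows "(\<Sum>i<N. a i) powr p \<le> 2 powr p * real N powr (p - 1) * (\<Sum>i<N. a i powr p)"
proof (cases "\<forall>i<N. a i = 0")
  case True
  then have "(\<Sum>i<N. a i) = 0"
    by simp
  then show ?thesis
    using p by (simp add: sum_nonneg)
next
  case False
  then obtain i where "i < N" "a i \<noteq> 0"
    by auto
  then have "0 < (\<Sum>i<N. a i powr p)"
    by (intro sum_pos2[of _ i]) auto
  then have S: "0 < (\<Sum>i<N. a i powr p) / N"
    using N by simp
  \<comment> \<open>The \<open>L\<^sup>p\<close> mean of the summands makes both terms of \<open>le_add_powr_div_powr\<close> sum to \<open>N * M\<close>.\<close>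
  define M where "M = ((\<Sum>i<N. a i powr p) / N) powr (1 / p)"
  have M: "0 < M" and Mp: "M powr p = (\<Sum>i<N. a i powr p) / N"
    using S p by (auto simp: M_def powr_powr zero_less_divide_iff sum_nonneg)
  have "(\<Sum>i<N. a i) \<le> (\<Sum>i<N. M + a i powr p / M powr (p - 1))"
    using a M p by (intro sum_mono le_add_powr_div_powr) auto
  also have "\<dots> = N * M + (\<Sum>i<N. a i powr p) / M powr (p - 1)"
    by (simp add: sum.distrib sum_divide_distrib)
  also have "(\<Sum>i<N. a i powr p) = N * M powr p"
    using Mp N by simp
  also have "N * M + N * M powr p / M powr (p - 1) = 2 * N * M"
    by (simp only: times_divide_eq_right[symmetric] powr_div_powr_pred[OF M])
  finally have "(\<Sum>i<N. a i) powr p \<le> (2 * N * M) powr p"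
    using a p by (intro powr_mono2) (auto intro: sum_nonneg)
  also have "\<dots> = 2 powr p * (real N powr p * M powr p)"
    using M N by (simp add: powr_mult mult_ac)
  also have "real N powr p = real N powr (p - 1) * N"
    using N powr_add[of "real N" "p - 1" 1] by simp
  also have "real N powr (p - 1) * N * M powr p = real N powr (p - 1) * (\<Sum>i<N. a i powr p)"
    using N Mp by simp
  finally show ?thesis
    by (simp add: mult_ac)
qed

text \<open>
  The difference of two averages is the average of \<open>f x - g y\<close>, whose \<open>L\<^sup>1\<close> norm
  \<open>le_add_powr_div_powr\<close> bounds by twice a bound \<open>M\<close> of its \<open>L\<^sup>p\<close> norm. With a Dirac measure as one of
  the two measures this also compares a value with an average.
\<close>

lemma expectation_diff_le:
  fixes f :: "'a \<Rightarrow> real" and g :: "'b \<Rightarrow> real"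
  assumes P: "prob_space P" and Q: "prob_space Q"
    and f[measurable]: "f \<in> borel_measurable P" and g[measurable]: "g \<in> borel_measurable Q"
    and bf: "\<And>x. \<bar>f x\<bar> \<le> B" and bg: "\<And>x. \<bar>g x\<bar> \<le> B"
    and M: "0 < M" and p: "1 \<le> p"
    and le: "(\<integral>\<^sup>+x. \<integral>\<^sup>+y. ennreal (\<bar>f x - g y\<bar> powr p) \<partial>Q \<partial>P) \<le> ennreal (M powr p)"
  shows "\<bar>integral\<^sup>L P f - integral\<^sup>L Q g\<bar> \<le> 2 * M"
proof -
  interpret P: prob_space P by fact
  interpret Q: prob_space Q by fact
  have intf: "integrable P f"
    using bf by (intro P.integrable_const_bound[of _ B]) auto
  have intg: "integrable Q g"
    using bg by (intro Q.integrable_const_bound[of _ B]) auto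
  have "integral\<^sup>L P f - integral\<^sup>L Q g = (\<integral>x. f x - integral\<^sup>L Q g \<partial>P)"
    using intf by (simp add: P.prob_space)
  then have "ennreal \<bar>integral\<^sup>L P f - integral\<^sup>L Q g\<bar> \<le> (\<integral>\<^sup>+x. norm (f x - integral\<^sup>L Q g) \<partial>P)"
    using integral_norm_bound_ennreal[of P "\<lambda>x. f x - integral\<^sup>L Q g"] intf by (simp add: P.prob_space)
  also have "\<dots> \<le> (\<integral>\<^sup>+x. \<integral>\<^sup>+y. norm (f x - g y) \<partial>Q \<partial>P)"
  proof (rule nn_integral_mono)
    fix x
    have "f x - integral\<^sup>L Q g = (\<integral>y. f x - g y \<partial>Q)"
      using intg by (simp add: Q.prob_space)
    then show "ennreal (norm (f x - integral\<^sup>L Q g)) \<le> (\<integral>\<^sup>+y. norm (f x - g y) \<partial>Q)"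
      using integral_norm_bound_ennreal[of Q "\<lambda>y. f x - g y"] intg by (simp add: Q.prob_space)
  qed
  also have "\<dots> \<le> (\<integral>\<^sup>+x. \<integral>\<^sup>+y. ennreal M + ennreal (1 / M powr (p - 1)) * ennreal (\<bar>f x - g y\<bar> powr p) \<partial>Q \<partial>P)"
  proof (intro nn_integral_mono)
    fix x y
    show "ennreal (norm (f x - g y)) \<le> ennreal M + ennreal (1 / M powr (p - 1)) * ennreal (\<bar>f x - g y\<bar> powr p)"
      using le_add_powr_div_powr[of "\<bar>f x - g y\<bar>" M p] M p
      by (simp flip: ennreal_mult ennreal_plus)
  qed
  also have "\<dots> = ennreal M + ennreal (1 / M powr (p - 1)) *
      (\<integral>\<^sup>+x. \<integral>\<^sup>+y. ennreal (\<bar>f x - g y\<bar> powr p) \<partial>Q \<partial>P)"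
    by (simp add: nn_integral_add nn_integral_cmult P.emeasure_space_1 Q.emeasure_space_1)
  also have "\<dots> \<le> ennreal M + ennreal (1 / M powr (p - 1)) * ennreal (M powr p)"
    by (intro add_left_mono mult_left_mono le) auto
  also have "\<dots> = ennreal (2 * M)"
    using M powr_div_powr_pred[OF M, of p] by (simp flip: ennreal_mult ennreal_plus)
  finally show ?thesis
    using M by (simp add: ennreal_le_iff)
qed

section \<open>A nonlocal Poincare inequality on convex sets\<close>

lemma nn_integral_lborel_affine:
  fixes f :: "'a::euclidean_space \<Rightarrow> ennreal"
  assumes [measurable]: "f \<in> borel_measurable borel" and c: "c \<noteq> 0"
  shows "(\<integral>\<^sup>+z. f z \<partial>lborel) = ennreal (\<bar>c\<bar> ^ DIM('a)) * (\<integral>\<^sup>+z. f (t + c *\<^sub>R z) \<partial>lborel)"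
  by (subst lborel_affine[OF c, of t]) (simp add: nn_integral_density nn_integral_distr nn_integral_cmult ennreal_power)

text \<open>
  Pairs of points of \<open>Q\<close> at arbitrary distance are controlled by pairs at distance at most \<open>h\<close>: the
  segment from \<open>y\<close> to \<open>z = y + N k\<close> is cut into \<open>N\<close> steps \<open>k\<close>, which stay in \<open>Q\<close> by convexity. The
  substitution \<open>z = y + N k\<close> costs a factor \<open>N\<close> to the dimension, the power-mean inequality a factor
  \<open>N powr (p - 1)\<close>, and translation invariance makes all \<open>N\<close> steps contribute the same integral.
\<close>

lemma nonlocal_poincare:
  fixes f :: "'a::euclidean_space \<Rightarrow> real"
  assumes [measurable]: "f \<in> borel_measurable borel" "Q \<in> sets borel"
    and Q: "convex Q" and p: "1 \<le> p" and N: "0 < N"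
    and diam: "\<And>y z. y \<in> Q \<Longrightarrow> z \<in> Q \<Longrightarrow> norm (z - y) \<le> real N * h"
  shows "(\<integral>\<^sup>+y. \<integral>\<^sup>+z. ennreal (\<bar>f y - f z\<bar> powr p) * indicator (Q \<times> Q) (y, z) \<partial>lborel \<partial>lborel)
    \<le> ennreal (2 powr p * real N powr (p + DIM('a))) *
       (\<integral>\<^sup>+y. \<integral>\<^sup>+z. ennreal (\<bar>f y - f z\<bar> powr p) * indicator (Q \<times> Q) (y, z) *
          indicator {..h} (norm (z - y)) \<partial>lborel \<partial>lborel)"
proof -
  have N0: "real N \<noteq> 0" using N by simp
  define K where "K = (\<lambda>y z. ennreal (\<bar>f y - f z\<bar> powr p) * indicator (Q \<times> Q) (y, z))"
  define H where "H = (\<lambda>y z. K y z * indicator {..h} (norm (z - y)))"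
  have K[measurable]: "case_prod K \<in> borel_measurable (borel \<Otimes>\<^sub>M borel)"
    unfolding K_def by measurable
  have H[measurable]: "case_prod H \<in> borel_measurable (borel \<Otimes>\<^sub>M borel)"
    unfolding H_def by measurable
  define c where "c = 2 powr p * real N powr (p - 1)"
  have c: "0 \<le> c" by (simp add: c_def)
  have chain: "K y (y + real N *\<^sub>R k) \<le>
      ennreal c * (\<Sum>i<N. H (y + real i *\<^sub>R k) (y + real i *\<^sub>R k + k))" for y k
  proof (cases "y \<in> Q \<and> y + real N *\<^sub>R k \<in> Q")
    case True
    define x where "x = (\<lambda>i::nat. y + real i *\<^sub>R k)"
    have xQ: "x i \<in> Q" if "i \<le> N" for i
    proof -
      have "x i = (1 - real i / N) *\<^sub>R y + (real i / N) *\<^sub>R (y + real N *\<^sub>R k)"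
        using N0 by (simp add: x_def algebra_simps)
      then show ?thesis
        using Q True that N by (auto intro!: convexD simp: divide_le_eq_1)
    qed
    have xS: "x (Suc i) = y + real i *\<^sub>R k + k" for i
      by (simp add: x_def algebra_simps)
    have "real N * norm k \<le> real N * h"
      using diam[of y "y + real N *\<^sub>R k"] True by simp
    then have k: "norm k \<le> h"
      using N by simp
    have "\<bar>f (x 0) - f (x N)\<bar> = \<bar>\<Sum>i<N. f (x i) - f (x (Suc i))\<bar>"
      using sum_lessThan_telescope'[of "\<lambda>i. f (x i)" N] by simp
    also have "\<dots> \<le> (\<Sum>i<N. \<bar>f (x i) - f (x (Suc i))\<bar>)"
      by (rule sum_abs)
    finally have "\<bar>f (x 0) - f (x N)\<bar> powr p \<le> (\<Sum>i<N. \<bar>f (x i) - f (x (Suc i))\<bar>) powr p"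
      using p by (intro powr_mono2) auto
    also have "\<dots> \<le> c * (\<Sum>i<N. \<bar>f (x i) - f (x (Suc i))\<bar> powr p)"
      unfolding c_def using N p by (intro powr_sum_le) auto
    finally have "ennreal (\<bar>f (x 0) - f (x N)\<bar> powr p) \<le>
        ennreal c * (\<Sum>i<N. ennreal (\<bar>f (x i) - f (x (Suc i))\<bar> powr p))"
      using c by (simp add: sum_ennreal ennreal_leI sum_nonneg flip: ennreal_mult)
    also have "(\<Sum>i<N. ennreal (\<bar>f (x i) - f (x (Suc i))\<bar> powr p)) = (\<Sum>i<N. H (x i) (x (Suc i)))"
      using xQ k by (intro sum.cong refl) (simp add: H_def K_def Suc_leI xS less_imp_le flip: xS, simp add: x_def algebra_simps)
    finally show ?thesis
      using True by (simp add: K_def xS) (simp add: x_def)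
  qed (auto simp: K_def)
  \<comment> \<open>After exchanging the integrals, the increment \<open>k\<close> is fixed, so that \<open>y\<close> can be shifted by \<open>i k\<close>.\<close>
  have "(\<integral>\<^sup>+y. \<integral>\<^sup>+z. K y z \<partial>lborel \<partial>lborel) =
      (\<integral>\<^sup>+y. ennreal (real N ^ DIM('a)) * (\<integral>\<^sup>+k. K y (y + real N *\<^sub>R k) \<partial>lborel) \<partial>lborel)"
    by (intro nn_integral_cong, subst nn_integral_lborel_affine[OF _ N0]) simp_all
  also have "\<dots> \<le> (\<integral>\<^sup>+y. ennreal (real N ^ DIM('a)) * (\<integral>\<^sup>+k. ennreal c * (\<Sum>i<N. H (y + real i *\<^sub>R k) (y
      + real i *\<^sub>R k + k)) \<partial>lborel) \<partial>lborel)"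
    by (intro nn_integral_mono mult_left_mono chain) auto
  also have "\<dots> = ennreal (real N ^ DIM('a)) * (ennreal c * (\<integral>\<^sup>+y. \<integral>\<^sup>+k. (\<Sum>i<N. H (y + real i *\<^sub>R k) (y
      + real i *\<^sub>R k + k)) \<partial>lborel \<partial>lborel))"
    by (simp add: nn_integral_cmult)
  also have "(\<integral>\<^sup>+y. \<integral>\<^sup>+k. (\<Sum>i<N. H (y + real i *\<^sub>R k) (y + real i *\<^sub>R k + k)) \<partial>lborel \<partial>lborel)
      = (\<integral>\<^sup>+k. \<integral>\<^sup>+y. (\<Sum>i<N. H (y + real i *\<^sub>R k) (y + real i *\<^sub>R k + k)) \<partial>lborel \<partial>lborel)"
    by (rule lborel_pair.Fubini'[of "\<lambda>k y. \<Sum>i<N. H (y + real i *\<^sub>R k) (y + real i *\<^sub>R k + k)"]) measurable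
  also have "\<dots> = (\<integral>\<^sup>+k. (\<Sum>i<N. \<integral>\<^sup>+y. H (y + real i *\<^sub>R k) (y + real i *\<^sub>R k + k) \<partial>lborel) \<partial>lborel)"
    by (simp add: nn_integral_sum)
  also have "\<dots> = (\<integral>\<^sup>+k. (\<Sum>i<N. \<integral>\<^sup>+y. H y (y + k) \<partial>lborel) \<partial>lborel)"
  proof (rule nn_integral_cong, rule sum.cong[OF refl])
    fix k :: 'a and i
    show "(\<integral>\<^sup>+y. H (y + real i *\<^sub>R k) (y + real i *\<^sub>R k + k) \<partial>lborel) = (\<integral>\<^sup>+y. H y (y + k) \<partial>lborel)"
      using nn_integral_lborel_affine[of "\<lambda>y. H y (y + k)" 1 "real i *\<^sub>R k"]
      by (simp add: add.commute add.left_commute)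
  qed
  also have "\<dots> = of_nat N * (\<integral>\<^sup>+k. \<integral>\<^sup>+y. H y (y + k) \<partial>lborel \<partial>lborel)"
    by (simp add: nn_integral_cmult)
  also have "(\<integral>\<^sup>+k. \<integral>\<^sup>+y. H y (y + k) \<partial>lborel \<partial>lborel) = (\<integral>\<^sup>+y. \<integral>\<^sup>+k. H y (y + k) \<partial>lborel \<partial>lborel)"
    by (rule lborel_pair.Fubini'[symmetric]) measurable
  also have "\<dots> = (\<integral>\<^sup>+y. \<integral>\<^sup>+z. H y z \<partial>lborel \<partial>lborel)"
  proof (rule nn_integral_cong)
    fix y :: 'a
    show "(\<integral>\<^sup>+k. H y (y + k) \<partial>lborel) = (\<integral>\<^sup>+z. H y z \<partial>lborel)"
      using nn_integral_lborel_affine[of "\<lambda>z. H y z" 1 y] by simp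
  qed
  finally have "(\<integral>\<^sup>+y. \<integral>\<^sup>+z. K y z \<partial>lborel \<partial>lborel) \<le>
      ennreal (real N ^ DIM('a)) * (ennreal c * (of_nat N * (\<integral>\<^sup>+y. \<integral>\<^sup>+z. H y z \<partial>lborel \<partial>lborel)))" .
  also have "\<dots> = ennreal (real N ^ DIM('a) * c * real N) * (\<integral>\<^sup>+y. \<integral>\<^sup>+z. H y z \<partial>lborel \<partial>lborel)"
    using c by (simp add: ennreal_mult ennreal_of_nat_eq_real_of_nat mult.assoc)
  also have "real N ^ DIM('a) * c * real N = 2 powr p * ((real N powr (p - 1) * real N powr 1) * real N powr DIM('a))"
    using N by (simp add: c_def powr_realpow)
  also have "\<dots> = 2 powr p * real N powr (p + DIM('a))"
    by (simp only: powr_add[symmetric]) simp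
  finally show ?thesis
    unfolding H_def K_def .
qed

section \<open>Averages with respect to Lebesgue measure\<close>

definition mean :: "('a::euclidean_space \<Rightarrow> real) \<Rightarrow> 'a set \<Rightarrow> real" where
  "mean f A = (\<integral>x. f x \<partial>uniform_measure lborel A)"

lemma ennreal_divide_le:
  assumes "a \<le> ennreal X" "ennreal m \<le> b" "0 \<le> X" "0 < m"
  shows "a / b \<le> ennreal (X / m)"
proof (cases b rule: ennreal_cases)
  case (real r)
  then have mr: "m \<le> r"
    using assms by simp
  have "a / b \<le> ennreal X / ennreal r"
    unfolding real(2) by (intro divide_right_mono_ennreal assms)
  also have "\<dots> = ennreal (X / r)"
    using assms mr by (simp add: divide_ennreal)
  also have "\<dots> \<le> ennreal (X / m)"
    using assms mr by (intro ennreal_leI divide_left_mono) auto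
  finally show ?thesis .
qed simp

lemma nn_integral_uniform_measure_le:
  fixes F :: "'a::euclidean_space \<Rightarrow> ennreal"
  assumes [measurable]: "F \<in> borel_measurable borel" "A \<in> sets borel"
    and "ennreal m \<le> emeasure lborel A" "0 < m"
    and "(\<integral>\<^sup>+y. F y * indicator A y \<partial>lborel) \<le> ennreal X" "0 \<le> X"
  shows "(\<integral>\<^sup>+y. F y \<partial>uniform_measure lborel A) \<le> ennreal (X / m)"
  using assms(3-) by (subst nn_integral_uniform_measure) (auto intro: ennreal_divide_le)

lemma nn_integral_uniform_measure_pair_le:
  fixes F :: "'a::euclidean_space \<Rightarrow> 'a \<Rightarrow> ennreal"
  assumes [measurable]: "case_prod F \<in> borel_measurable (borel \<Otimes>\<^sub>M borel)" "A \<in> sets borel" "B \<in> sets borel"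
    and m: "ennreal m \<le> emeasure lborel A" "ennreal m \<le> emeasure lborel B" "0 < m"
    and X: "(\<integral>\<^sup>+x. \<integral>\<^sup>+y. F x y * indicator (A \<times> B) (x, y) \<partial>lborel \<partial>lborel) \<le> ennreal X" "0 \<le> X"
  shows "(\<integral>\<^sup>+x. \<integral>\<^sup>+y. F x y \<partial>uniform_measure lborel B \<partial>uniform_measure lborel A) \<le> ennreal (X / m / m)"
proof -
  have "(\<integral>\<^sup>+x. \<integral>\<^sup>+y. F x y \<partial>uniform_measure lborel B \<partial>uniform_measure lborel A) =
     (\<integral>\<^sup>+x. (\<integral>\<^sup>+y. F x y * indicator B y \<partial>lborel) / emeasure lborel B \<partial>uniform_measure lborel A)"
    by (intro nn_integral_cong nn_integral_uniform_measure) auto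
  also have "\<dots> \<le> ennreal ((X / m) / m)"
  proof (intro nn_integral_uniform_measure_le m)
    have "(\<integral>\<^sup>+x. (\<integral>\<^sup>+y. F x y * indicator B y \<partial>lborel) / emeasure lborel B * indicator A x \<partial>lborel)
        = (\<integral>\<^sup>+x. (\<integral>\<^sup>+y. F x y * indicator (A \<times> B) (x, y) \<partial>lborel) / emeasure lborel B \<partial>lborel)"
      by (intro nn_integral_cong) (auto simp: indicator_def)
    also have "\<dots> = (\<integral>\<^sup>+x. (\<integral>\<^sup>+y. F x y * indicator (A \<times> B) (x, y) \<partial>lborel) \<partial>lborel) / emeasure lborel B"
      by (simp add: nn_integral_divide)
    also have "\<dots> \<le> ennreal (X / m)"
      using m X by (intro ennreal_divide_le)
    finally show "(\<integral>\<^sup>+x. (\<integral>\<^sup>+y. F x y * indicator B y \<partial>lborel) / emeasure lborel B * indicator A x \<partial>lborel)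
        \<le> ennreal (X / m)" .
  qed (use m X in auto)
  finally show ?thesis .
qed

lemma prob_space_uniform_measure_lborel:
  fixes A :: "'a::euclidean_space set"
  assumes "ennreal m \<le> emeasure lborel A" "0 < m" "bounded A"
  shows "prob_space (uniform_measure lborel A)"
proof (rule prob_space_uniform_measure)
  show "emeasure lborel A \<noteq> 0"
    using assms by (metis ennreal_le_iff2 linorder_not_le order.refl zero_ennreal_def ennreal_eq_0_iff le_zero_eq)
  show "emeasure lborel A \<noteq> \<infinity>"
    using emeasure_bounded_finite[OF assms(3)] by simp
qed

text \<open>
  Apart from the case \<open>a = f x\<close>, the case \<open>a = 0\<close> bounds the average itself by the \<open>L\<^sup>p\<close> norm.
\<close>

lemma point_mean_diff_le:
  fixes f :: "'a::euclidean_space \<Rightarrow> real"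
  assumes f[measurable]: "f \<in> borel_measurable borel" and bf: "\<And>x. \<bar>f x\<bar> \<le> B" and p: "1 \<le> p"
    and A[measurable]: "A \<in> sets borel" "bounded A" and m: "ennreal m \<le> emeasure lborel A" "0 < m"
    and X: "(\<integral>\<^sup>+y. ennreal (\<bar>a - f y\<bar> powr p) * indicator A y \<partial>lborel) \<le> ennreal X" "0 < X"
    and a: "\<bar>a\<bar> \<le> B"
  shows "\<bar>a - mean f A\<bar> \<le> 2 * (X / m) powr (1 / p)"
proof -
  have "\<bar>integral\<^sup>L (return borel (0::real)) (\<lambda>_. a) - mean f A\<bar> \<le> 2 * (X / m) powr (1 / p)"
    unfolding mean_def
  proof (rule expectation_diff_le)
    show "prob_space (return borel (0::real))"
      by (simp add: prob_space_return)
    show "prob_space (uniform_measure lborel A)"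
      using m A by (intro prob_space_uniform_measure_lborel)
    have "(\<integral>\<^sup>+y. ennreal (\<bar>a - f y\<bar> powr p) \<partial>uniform_measure lborel A) \<le> ennreal (X / m)"
      using X m by (intro nn_integral_uniform_measure_le) auto
    then show "(\<integral>\<^sup>+x. \<integral>\<^sup>+y. ennreal (\<bar>a - f y\<bar> powr p) \<partial>uniform_measure lborel A \<partial>return borel (0::real))
       \<le> ennreal (((X / m) powr (1 / p)) powr p)"
      using X m p by (simp add: nn_integral_return powr_powr)
  qed (use assms in auto)
  moreover have "Sigma_Algebra.measure (return borel (0::real)) UNIV = 1"
    by (simp add: measure_return)
  ultimately show ?thesis
    by simp
qed

lemma mean_diff_le:
  fixes f :: "'a::euclidean_space \<Rightarrow> real"
  assumes f[measurable]: "f \<in> borel_measurable borel" and bf: "\<And>x. \<bar>f x\<bar> \<le> K" and p: "1 \<le> p"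
    and A[measurable]: "A \<in> sets borel" "bounded A" and mA: "ennreal m \<le> emeasure lborel A"
    and B[measurable]: "B \<in> sets borel" "bounded B" and mB: "ennreal m \<le> emeasure lborel B"
    and m: "0 < m"
    and X: "(\<integral>\<^sup>+y. \<integral>\<^sup>+z. ennreal (\<bar>f y - f z\<bar> powr p) * indicator (A \<times> B) (y, z) \<partial>lborel \<partial>lborel)
        \<le> ennreal X" "0 < X"
  shows "\<bar>mean f A - mean f B\<bar> \<le> 2 * (X / m\<^sup>2) powr (1 / p)"
  unfolding mean_def
proof (rule expectation_diff_le)
  show "prob_space (uniform_measure lborel A)" "prob_space (uniform_measure lborel B)"
    using A B mA mB m by (auto intro!: prob_space_uniform_measure_lborel[of m])
  have "(\<integral>\<^sup>+y. \<integral>\<^sup>+z. ennreal (\<bar>f y - f z\<bar> powr p) \<partial>uniform_measure lborel B \<partial>uniform_measure lborel A)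
      \<le> ennreal (X / m / m)"
    using X m mA mB by (intro nn_integral_uniform_measure_pair_le) auto
  then show "(\<integral>\<^sup>+y. \<integral>\<^sup>+z. ennreal (\<bar>f y - f z\<bar> powr p) \<partial>uniform_measure lborel B \<partial>uniform_measure lborel A)
       \<le> ennreal (((X / m\<^sup>2) powr (1 / p)) powr p)"
    using X m p by (simp add: powr_powr power2_eq_square)
qed (use assms in auto)

section \<open>Cones\<close>

text \<open>
  Abstraction of a truncated cone with vertex \<open>0\<close>. Convexity and \<open>0 \<in> C\<close> make the rescalings \<open>r C\<close>
  nested, and the inscribed ball of radius \<open>s\<close> bounds their volume from below by a constant that
  depends on \<open>s\<close> only.
\<close>

definition cone_like :: "real \<Rightarrow> 'a::euclidean_space set \<Rightarrow> bool" where
  "cone_like s C \<longleftrightarrow> compact C \<and> convex C \<and> 0 \<in> C \<and> C \<subseteq> cball 0 1 \<and> (\<exists>b. ball b s \<subseteq> C)"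

text \<open>
  Nearby points admit a common cone: the cones at \<open>x\<close> and at \<open>y\<close>, rescaled to size comparable with
  \<open>dist x y\<close>, then overlap in a ball of that size, which links the averages around \<open>x\<close> and around \<open>y\<close>.
\<close>

definition uniform_cone_property :: "real \<Rightarrow> real \<Rightarrow> 'a::euclidean_space set \<Rightarrow> bool" where
  "uniform_cone_property \<delta> s \<Omega> \<longleftrightarrow>
     (\<forall>x\<in>\<Omega>. \<forall>y\<in>\<Omega>. dist x y < \<delta> \<longrightarrow>
        (\<exists>C. cone_like s C \<and> (\<forall>v\<in>C. x + v \<in> \<Omega> \<and> y + v \<in> \<Omega>)))"

definition cone_at :: "'a::euclidean_space set \<Rightarrow> 'a \<Rightarrow> real \<Rightarrow> 'a set" where
  "cone_at C x r = (\<lambda>v. x + r *\<^sub>R v) ` C"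

lemma cone_at_compact: "cone_like s C \<Longrightarrow> compact (cone_at C x r)"
  unfolding cone_like_def cone_at_def by (intro compact_continuous_image continuous_intros) auto

lemma cone_at_convex: "cone_like s C \<Longrightarrow> convex (cone_at C x r)"
  using convex_affinity[of C x r] by (simp add: cone_like_def cone_at_def)

lemma cone_at_dist: "cone_like s C \<Longrightarrow> 0 \<le> r \<Longrightarrow> y \<in> cone_at C x r \<Longrightarrow> dist x y \<le> r"
  by (auto simp: cone_like_def cone_at_def dist_norm subset_iff mult_left_le)

lemma cone_at_mono:
  assumes "cone_like s C" "0 \<le> r" "r \<le> r'"
  shows "cone_at C x r \<subseteq> cone_at C x r'"
proof
  fix y assume "y \<in> cone_at C x r"
  then obtain v where v: "v \<in> C" "y = x + r *\<^sub>R v"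
    by (auto simp: cone_at_def)
  show "y \<in> cone_at C x r'"
  proof (cases "r' = 0")
    case False
    then have "(r / r') *\<^sub>R v + (1 - r / r') *\<^sub>R 0 \<in> C"
      using assms v by (intro convexD) (auto simp: cone_like_def)
    then have "(r / r') *\<^sub>R v \<in> C" by simp
    then show ?thesis
      using v False by (auto simp: cone_at_def intro!: image_eqI[of _ _ "(r / r') *\<^sub>R v"])
  qed (use assms v in \<open>auto simp: cone_at_def\<close>)
qed

lemma cone_at_ball:
  assumes "ball b s \<subseteq> C" "0 < r"
  shows "ball (x + r *\<^sub>R b) (r * s) \<subseteq> cone_at C x r"
proof
  fix y assume y: "y \<in> ball (x + r *\<^sub>R b) (r * s)"
  define v where "v = (y - x) /\<^sub>R r"
  have "r * dist b v = norm (r *\<^sub>R (b - v))"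
    using assms by (simp add: dist_norm)
  also have "r *\<^sub>R (b - v) = x + r *\<^sub>R b - y"
    using assms by (simp add: v_def algebra_simps)
  also have "norm (x + r *\<^sub>R b - y) < r * s"
    using y by (simp add: dist_norm)
  finally have "v \<in> C"
    using assms by auto
  then show "y \<in> cone_at C x r"
    using assms by (auto simp: cone_at_def v_def intro!: image_eqI[of _ _ v])
qed

text \<open>
  Volume of a ball of radius \<open>s / 2\<close> in dimension \<open>d\<close>. The factor one half leaves room for the half-size
  cone at the same vertex and for a ball inside two overlapping cones.
\<close>

definition cone_volume :: "nat \<Rightarrow> real \<Rightarrow> real" where
  "cone_volume d s = unit_ball_vol d * (s / 2) ^ d"

section \<open>Nonlocal Morrey inequality\<close>

text \<open>
  If means at scale \<open>r\<close> are taken over sets of volume at least \<open>\<beta> * r ^ d\<close>, two of them differ by at most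
  this constant times \<open>r powr (1 - d / p)\<close>.
\<close>

definition campanato_const :: "nat \<Rightarrow> real \<Rightarrow> real \<Rightarrow> real \<Rightarrow> real" where
  "campanato_const d p E \<beta> = 2 * (2 powr p * 3 powr (p + real d) * E / \<beta>\<^sup>2) powr (1 / p)"

lemma cone_volume_pos: "0 < s \<Longrightarrow> 0 < cone_volume d s"
  by (simp add: cone_volume_def unit_ball_vol_pos)

lemma emeasure_ball_cone_volume:
  fixes c :: "'a::euclidean_space"
  assumes "0 < s" "0 < r" "r * s / 2 \<le> t"
  shows "ennreal (cone_volume DIM('a) s * r ^ DIM('a)) \<le> emeasure lborel (ball c t)"
proof -
  have "(s / 2) ^ DIM('a) * r ^ DIM('a) \<le> t ^ DIM('a)"
    using assms by (simp flip: power_mult_distrib add: power_mono mult.commute)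
  moreover have "0 \<le> t"
    using assms mult_pos_pos[of r s] by linarith
  ultimately show ?thesis
    using assms by (subst emeasure_ball) (auto simp: cone_volume_def mult.assoc intro!: ennreal_leI mult_left_mono)
qed

lemma campanato_const_nonneg: "0 \<le> campanato_const d p E \<beta>"
  by (simp add: campanato_const_def)

text \<open>
  The hypotheses under which a function behaves, at scales from \<open>h\<close> upwards, like an element of
  \<open>W\<^sup>1\<^sup>,\<^sup>p\<close> for an exponent above the dimension. The nonlocal energy is normalised so that \<open>E\<close> plays the
  role of the integral of the gradient to the power \<open>p\<close>. Since this energy says nothing about single points, the
  oscillation around each point at scale \<open>h\<close> is bounded separately, by \<open>\<delta>\<close>. All constants derived below
  depend on \<open>E\<close> and \<open>M\<close>, but not on \<open>h\<close>, \<open>\<delta>\<close> and \<open>f\<close>.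
\<close>

locale nonlocal_energy_bound =
  fixes \<Omega> :: "'a::euclidean_space set" and p \<gamma> h E \<delta> M :: real and f :: "'a \<Rightarrow> real"
  assumes f[measurable]: "f \<in> borel_measurable borel"
    and bounded_f: "bounded (range f)"
    and p: "DIM('a) < p" and \<gamma>_eq: "\<gamma> = 1 - DIM('a) / p" and h: "0 < h" "h
        \<le> 1" and E: "0 < E" and \<delta>: "0 < \<delta>" and M: "0 < M"
    and energy: "(\<integral>\<^sup>+y. \<integral>\<^sup>+z. ennreal (\<bar>f y - f z\<bar> powr p) * indicator (\<Omega> \<times> \<Omega>) (y, z) *
          indicator {..h} (norm (z - y)) \<partial>lborel \<partial>lborel) \<le> ennreal (E * h powr (p + DIM('a)))"
    and oscillation: "\<And>x. x \<in> \<Omega> \<Longrightarrow> (\<integral>\<^sup>+y. ennreal (\<bar>f x - f y\<bar> powr p) * indicator \<Omega> y *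
          indicator {..2 * h} (norm (y - x)) \<partial>lborel) \<le> ennreal (\<delta> powr p * h ^ DIM('a))"
    and Lp: "(\<integral>\<^sup>+y. ennreal (\<bar>f y\<bar> powr p) * indicator \<Omega> y \<partial>lborel) \<le> ennreal M"
begin

lemma p1: "1 < p" and \<gamma>: "0 < \<gamma>" "\<gamma> < 1"
proof -
  have "1 \<le> real DIM('a)"
    by (simp add: Suc_leI)
  then show "1 < p" using p by linarith
  then show "0 < \<gamma>" "\<gamma> < 1"
    using p by (auto simp: \<gamma>_eq divide_less_eq_1)
qed

text \<open>
  The Poincare inequality on \<open>Q\<close> with about \<open>r / h\<close> steps turns the energy bound at scale \<open>h\<close> into a
  bound at scale \<open>r\<close>, in which \<open>h\<close> cancels.
\<close>

lemma mean_diff_le_powr: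
  assumes A: "A \<in> sets borel" "A \<subseteq> Q" and mA: "ennreal (\<beta> * r ^ DIM('a)) \<le> emeasure lborel A"
    and B: "B \<in> sets borel" "B \<subseteq> Q" and mB: "ennreal (\<beta> * r ^ DIM('a)) \<le> emeasure lborel B"
    and \<beta>: "0 < \<beta>" and r: "h \<le> r"
    and Q: "Q \<in> sets borel" "bounded Q" "convex Q" "Q \<subseteq> \<Omega>"
    and diam: "\<And>y z. y \<in> Q \<Longrightarrow> z \<in> Q \<Longrightarrow> norm (z - y) \<le> 2 * r"
  shows "\<bar>mean f A - mean f B\<bar> \<le> campanato_const DIM('a) p E \<beta> * r powr \<gamma>"
proof -
  obtain K where K: "\<And>x. \<bar>f x\<bar> \<le> K"
    using bounded_f by (auto simp: bounded_iff)
  define d where "d = real DIM('a)"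
  \<comment> \<open>Rounding up to an integer costs at most \<open>1 \<le> r / h\<close>; this is where \<open>h \<le> r\<close> enters.\<close>
  define N where "N = nat \<lceil>2 * r / h\<rceil>"
  have rh: "1 \<le> r / h" and r0: "0 < r"
    using r h by auto
  have N: "0 < N" "2 * r / h \<le> real N" "real N \<le> 3 * (r / h)"
    using rh unfolding N_def by linarith+
  have Nh: "2 * r \<le> real N * h"
    using N h by (simp add: pos_divide_le_eq)
  define X where "X = 2 powr p * 3 powr (p + d) * E * r powr (p + d)"
  have X: "0 < X" using E r0 by (simp add: X_def)
  have "(\<integral>\<^sup>+y. \<integral>\<^sup>+z. ennreal (\<bar>f y - f z\<bar> powr p) * indicator (A \<times> B) (y, z) \<partial>lborel \<partial>lborel)
     \<le> (\<integral>\<^sup>+y. \<integral>\<^sup>+z. ennreal (\<bar>f y - f z\<bar> powr p) * indicator (Q \<times> Q) (y, z) \<partial>lborel \<partial>lborel)"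
    using A B by (intro nn_integral_mono mult_left_mono) (auto simp: indicator_def)
  also have "\<dots> \<le> ennreal (2 powr p * real N powr (p + DIM('a))) *
       (\<integral>\<^sup>+y. \<integral>\<^sup>+z. ennreal (\<bar>f y - f z\<bar> powr p) * indicator (Q \<times> Q) (y, z) *
          indicator {..h} (norm (z - y)) \<partial>lborel \<partial>lborel)"
    using Q p1 N diam Nh by (intro nonlocal_poincare) (auto intro: order_trans)
  also have "\<dots> \<le> ennreal (2 powr p * real N powr (p + DIM('a))) *
       (\<integral>\<^sup>+y. \<integral>\<^sup>+z. ennreal (\<bar>f y - f z\<bar> powr p) * indicator (\<Omega> \<times> \<Omega>) (y, z) *
          indicator {..h} (norm (z - y)) \<partial>lborel \<partial>lborel)"
    using Q by (intro nn_integral_mono mult_left_mono mult_right_mono) (auto simp: indicator_def)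
  also have "\<dots> \<le> ennreal (2 powr p * (3 * (r / h)) powr (p + d)) * ennreal (E * h powr (p + d))"
    using energy N p1 unfolding d_def by (intro mult_mono ennreal_leI mult_left_mono powr_mono2) auto
  also have "\<dots> = ennreal X"
    using E h r0 by (simp add: X_def powr_mult powr_divide flip: ennreal_mult)
  finally have "\<bar>mean f A - mean f B\<bar> \<le> 2 * (X / (\<beta> * r ^ DIM('a))\<^sup>2) powr (1 / p)"
    using A B Q mA mB \<beta> r0 K p1 X by (intro mean_diff_le) (auto intro: bounded_subset)
  also have "X / (\<beta> * r ^ DIM('a))\<^sup>2 = (2 powr p * 3 powr (p + d) * E / \<beta>\<^sup>2) * (r powr (p
      + d) / (r powr d * r powr d))"
    using r0 by (simp add: X_def d_def powr_realpow power2_eq_square field_simps)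
  also have "r powr (p + d) / (r powr d * r powr d) = r powr (p - d)"
    using r0 by (simp flip: powr_add powr_diff)
  also have "((2 powr p * 3 powr (p + d) * E / \<beta>\<^sup>2) * r powr (p - d)) powr (1 / p) =
      (2 powr p * 3 powr (p + d) * E / \<beta>\<^sup>2) powr (1 / p) * r powr ((p - d) / p)"
    using E by (subst powr_mult) (simp_all add: powr_powr)
  also have "(p - d) / p = \<gamma>"
    using p1 by (simp add: d_def \<gamma>_eq diff_divide_distrib)
  finally show ?thesis
    by (simp add: d_def campanato_const_def)
qed

lemma cone_at_subset:
  assumes "cone_like s C" "\<And>v. v \<in> C \<Longrightarrow> x + v \<in> \<Omega>" "0 \<le> r" "r \<le> 1"
  shows "cone_at C x r \<subseteq> \<Omega>"
  using cone_at_mono[of s C r 1 x] assms by (auto simp: cone_at_def)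

lemma cone_mean_diff_le:
  assumes C: "cone_like s C" "0 < s" and x: "\<And>v. v \<in> C \<Longrightarrow> x + v \<in> \<Omega>" and r: "h \<le> r" "r \<le> 1"
    and A: "A \<in> sets borel" "A \<subseteq> cone_at C x r" "ball c (r * s / 2) \<subseteq> A"
  shows "\<bar>mean f (cone_at C x r) - mean f A\<bar> \<le> campanato_const DIM('a) p E (cone_volume DIM('a) s) * r powr \<gamma>"
proof (rule mean_diff_le_powr[where Q = "cone_at C x r"])
  have r0: "0 < r" using r h by simp
  have cpt: "compact (cone_at C x r)"
    using C by (simp add: cone_at_compact)
  then have Q: "cone_at C x r \<in> sets borel"
    by (simp add: borel_compact)
  show A': "ennreal (cone_volume DIM('a) s * r ^ DIM('a)) \<le> emeasure lborel A"
    using emeasure_ball_cone_volume[of s r "r * s / 2" c] emeasure_mono[of "ball c (r * s / 2)" A lborel] A r0 C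
    by simp
  show "ennreal (cone_volume DIM('a) s * r ^ DIM('a)) \<le> emeasure lborel (cone_at C x r)"
    using A' emeasure_mono[of A "cone_at C x r" lborel] A Q by simp
  show "cone_at C x r \<subseteq> \<Omega>"
    using C x r r0 by (intro cone_at_subset) auto
  show "norm (z - y) \<le> 2 * r" if "y \<in> cone_at C x r" "z \<in> cone_at C x r" for y z
    using cone_at_dist[OF C(1) _ that(1)] cone_at_dist[OF C(1) _ that(2)] r0 dist_triangle[of z y x]
    by (simp add: dist_norm norm_minus_commute)
qed (use A C r cone_at_compact[OF C(1), of x r]
    in \<open>auto simp: cone_volume_pos cone_at_convex[OF C(1)] borel_compact compact_imp_bounded\<close>)

text \<open>
  The cone at \<open>x\<close> is halved until its size is below \<open>2 h\<close>. The halvings contribute a geometric series,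
  whose sum is the quotient by \<open>1 - 2 powr - \<gamma>\<close>, and the last step is the oscillation bound around \<open>x\<close>.
  The number \<open>J\<close> of halvings serves only for the induction.
\<close>

lemma point_cone_mean_diff_le_dyadic:
  assumes C: "cone_like s C" "0 < s" and x: "\<And>v. v \<in> C \<Longrightarrow> x + v \<in> \<Omega>"
    and r: "h \<le> r" "r \<le> 1" "r < 2 ^ J * (2 * h)"
  shows "\<bar>f x - mean f (cone_at C x r)\<bar> \<le>
      campanato_const DIM('a) p E (cone_volume DIM('a) s) / (1 - 2 powr - \<gamma>) * r powr \<gamma> +
      2 * (\<delta> / cone_volume DIM('a) s powr (1 / p))"
  using r
proof (induction J arbitrary: r)
  case 0
  have r0: "0 < r" and r2: "r < 2 * h" using 0 h by auto
  obtain b where b: "ball b s \<subseteq> C" using C by (auto simp: cone_like_def)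
  define \<beta> where "\<beta> = cone_volume DIM('a) s"
  have \<beta>: "0 < \<beta>" using C by (simp add: \<beta>_def cone_volume_pos)
  obtain K where K: "\<And>x. \<bar>f x\<bar> \<le> K"
    using bounded_f by (auto simp: bounded_iff)
  have cpt: "compact (cone_at C x r)"
    using C by (simp add: cone_at_compact)
  have sub: "cone_at C x r \<subseteq> \<Omega>"
    using C x 0 r0 by (intro cone_at_subset) auto
  have x\<Omega>: "x \<in> \<Omega>"
    using x[of 0] C by (simp add: cone_like_def)
  have "\<bar>f x - mean f (cone_at C x r)\<bar> \<le> 2 * ((\<delta> powr p * h ^ DIM('a)) / (\<beta> * h ^ DIM('a))) powr (1 / p)"
  proof (rule point_mean_diff_le)
    have "ennreal (\<beta> * h ^ DIM('a)) \<le> emeasure lborel (ball (x + r *\<^sub>R b) (r * s))"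
      unfolding \<beta>_def using C h 0 r0 mult_mono[of h "2 * r" s s]
      by (intro emeasure_ball_cone_volume) auto
    also have "\<dots> \<le> emeasure lborel (cone_at C x r)"
      using cpt by (intro emeasure_mono cone_at_ball b r0) (auto simp: borel_compact)
    finally show "ennreal (\<beta> * h ^ DIM('a)) \<le> emeasure lborel (cone_at C x r)" .
    have "(\<integral>\<^sup>+y. ennreal (\<bar>f x - f y\<bar> powr p) * indicator (cone_at C x r) y \<partial>lborel)
        \<le> (\<integral>\<^sup>+y. ennreal (\<bar>f x - f y\<bar> powr p) * indicator \<Omega> y * indicator {..2 * h} (norm (y - x)) \<partial>lborel)"
    proof (intro nn_integral_mono)
      fix y
      show "ennreal (\<bar>f x - f y\<bar> powr p) * indicator (cone_at C x r) y \<le>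
          ennreal (\<bar>f x - f y\<bar> powr p) * indicator \<Omega> y * indicator {..2 * h} (norm (y - x))"
        using sub cone_at_dist[OF C(1), of r y x] r0 r2
        by (cases "y \<in> cone_at C x r") (auto simp: dist_norm norm_minus_commute)
    qed
    also have "\<dots> \<le> ennreal (\<delta> powr p * h ^ DIM('a))"
      by (rule oscillation[OF x\<Omega>])
    finally show "(\<integral>\<^sup>+y. ennreal (\<bar>f x - f y\<bar> powr p) * indicator (cone_at C x r) y \<partial>lborel)
        \<le> ennreal (\<delta> powr p * h ^ DIM('a))" .
    show "\<And>x. \<bar>f x\<bar> \<le> K" "\<bar>f x\<bar> \<le> K" by (rule K)+
  qed (use cpt p1 \<beta> h \<delta> in \<open>auto simp: borel_compact compact_imp_bounded\<close>)
  also have "\<dots> = 2 * (\<delta> / cone_volume DIM('a) s powr (1 / p))"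
    using h p1 \<delta> by (simp add: powr_divide powr_powr \<beta>_def)
  also have "\<dots> \<le> campanato_const DIM('a) p E (cone_volume DIM('a) s) / (1 - 2 powr - \<gamma>) * r powr \<gamma>
      + 2 * (\<delta> / cone_volume DIM('a) s powr (1 / p))"
    using campanato_const_nonneg[of "DIM('a)" p E "cone_volume DIM('a) s"] \<gamma>
        by (simp add: powr_minus_divide divide_le_eq_1 ge_one_powr_ge_zero)
  finally show ?case .
next
  case (Suc J)
  have r0: "0 < r" using Suc.prems h by auto
  define B where "B = campanato_const DIM('a) p E (cone_volume DIM('a) s) / (1 - 2 powr - \<gamma>)"
  have g: "2 powr - \<gamma> < 1"
    using \<gamma> by (simp add: powr_less_one)
  show ?case
  proof (cases "r < 2 * h")
    case True
    have "1 * (2 * h) \<le> 2 ^ J * (2 * h)"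
      using h by (intro mult_right_mono) auto
    with True have "r < 2 ^ J * (2 * h)"
      by linarith
    then show ?thesis using Suc.prems by (intro Suc.IH)
  next
    case False
    obtain b where b: "ball b s \<subseteq> C" using C by (auto simp: cone_like_def)
    have "\<bar>f x - mean f (cone_at C x (r / 2))\<bar>
        \<le> B * (r / 2) powr \<gamma> + 2 * (\<delta> / cone_volume DIM('a) s powr (1 / p))"
      unfolding B_def using Suc.prems False by (intro Suc.IH) auto
    moreover have "\<bar>mean f (cone_at C x r) - mean f (cone_at C x (r / 2))\<bar>
        \<le> campanato_const DIM('a) p E (cone_volume DIM('a) s) * r powr \<gamma>"
    proof (rule cone_mean_diff_le[OF C x])
      show "ball (x + (r / 2) *\<^sub>R b) (r * s / 2) \<subseteq> cone_at C x (r / 2)"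
        using cone_at_ball[OF b, of "r / 2" x] r0 by simp
      show "cone_at C x (r / 2) \<subseteq> cone_at C x r"
        using r0 by (intro cone_at_mono[OF C(1)]) auto
      show "cone_at C x (r / 2) \<in> sets borel"
        using cone_at_compact[OF C(1)] by (simp add: borel_compact)
    qed (use Suc.prems in auto)
    ultimately have "\<bar>f x - mean f (cone_at C x r)\<bar>
        \<le> B * (r / 2) powr \<gamma> + campanato_const DIM('a) p E (cone_volume DIM('a) s) * r powr \<gamma>
        + 2 * (\<delta> / cone_volume DIM('a) s powr (1 / p))"
      by linarith
    also have "(r / 2) powr \<gamma> = 2 powr - \<gamma> * r powr \<gamma>"
      using r0 by (simp add: powr_divide powr_minus_divide)
    also have "campanato_const DIM('a) p E (cone_volume DIM('a) s) = B * (1 - 2 powr - \<gamma>)"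
      using g \<gamma> by (simp add: B_def)
    also have "B * (2 powr - \<gamma> * r powr \<gamma>) + B * (1 - 2 powr - \<gamma>) * r powr \<gamma>
        + 2 * (\<delta> / cone_volume DIM('a) s powr (1 / p))
        = B * r powr \<gamma> + 2 * (\<delta> / cone_volume DIM('a) s powr (1 / p))"
      by (simp add: algebra_simps)
    finally show ?thesis by (simp add: B_def)
  qed
qed

lemma point_cone_mean_diff_le:
  assumes C: "cone_like s C" "0 < s" and x: "\<And>v. v \<in> C \<Longrightarrow> x + v \<in> \<Omega>"
    and r: "h \<le> r" "r \<le> 1"
  shows "\<bar>f x - mean f (cone_at C x r)\<bar> \<le>
    campanato_const DIM('a) p E (cone_volume DIM('a) s) / (1 - 2 powr - \<gamma>) * r powr \<gamma> +
    2 * (\<delta> / cone_volume DIM('a) s powr (1 / p))"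
proof -
  obtain J where "r / (2 * h) < 2 ^ J"
    using real_arch_pow[of 2 "r / (2 * h)"] by auto
  then have "r < 2 ^ J * (2 * h)"
    using h by (simp add: pos_divide_less_eq)
  then show ?thesis
    using assms by (intro point_cone_mean_diff_le_dyadic)
qed

text \<open>
  The average over the cone of full size is controlled by the \<open>L\<^sup>p\<close> norm.
\<close>

lemma value_abs_le:
  assumes C: "cone_like s C" "0 < s" and x: "\<And>v. v \<in> C \<Longrightarrow> x + v \<in> \<Omega>"
  shows "\<bar>f x\<bar> \<le> campanato_const DIM('a) p E (cone_volume DIM('a) s) / (1 - 2 powr - \<gamma>)
     + 2 * (M / cone_volume DIM('a) s) powr (1 / p) + 2 * (\<delta> / cone_volume DIM('a) s powr (1 / p))"
proof -
  obtain b where b: "ball b s \<subseteq> C" using C by (auto simp: cone_like_def)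
  obtain K where K: "\<And>x. \<bar>f x\<bar> \<le> K"
    using bounded_f by (auto simp: bounded_iff)
  have "0 \<le> K" using K[of x] by linarith
  have cpt: "compact (cone_at C x 1)"
    using C by (simp add: cone_at_compact)
  have sub: "cone_at C x 1 \<subseteq> \<Omega>"
    using C x by (intro cone_at_subset) auto
  have "\<bar>0 - mean f (cone_at C x 1)\<bar> \<le> 2 * (M / cone_volume DIM('a) s) powr (1 / p)"
  proof (rule point_mean_diff_le)
    have "ennreal (cone_volume DIM('a) s * 1 ^ DIM('a)) \<le> emeasure lborel (ball (x + 1 *\<^sub>R b) (1 * s))"
      using C by (intro emeasure_ball_cone_volume) auto
    also have "\<dots> \<le> emeasure lborel (cone_at C x 1)"
      using cpt by (intro emeasure_mono cone_at_ball b) (auto simp: borel_compact)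
    finally show "ennreal (cone_volume DIM('a) s) \<le> emeasure lborel (cone_at C x 1)"
      by simp
    have "(\<integral>\<^sup>+y. ennreal (\<bar>0 - f y\<bar> powr p) * indicator (cone_at C x 1) y \<partial>lborel)
        \<le> (\<integral>\<^sup>+y. ennreal (\<bar>f y\<bar> powr p) * indicator \<Omega> y \<partial>lborel)"
      using sub by (intro nn_integral_mono) (auto simp: indicator_def)
    also note Lp
    finally show "(\<integral>\<^sup>+y. ennreal (\<bar>0 - f y\<bar> powr p) * indicator (cone_at C x 1) y \<partial>lborel) \<le> ennreal M" .
  qed (use K cpt p1 M C \<open>0 \<le> K\<close> in \<open>auto simp: borel_compact compact_imp_bounded cone_volume_pos\<close>)
  moreover have "\<bar>f x - mean f (cone_at C x 1)\<bar> \<le>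
    campanato_const DIM('a) p E (cone_volume DIM('a) s) / (1 - 2 powr - \<gamma>) * 1 powr \<gamma> +
    2 * (\<delta> / cone_volume DIM('a) s powr (1 / p))"
    using C x h by (intro point_cone_mean_diff_le) auto
  ultimately show ?thesis
    by simp
qed

lemma close_diff_le:
  assumes C: "cone_like s C" "0 < s" and x: "\<And>v. v \<in> C \<Longrightarrow> x + v \<in> \<Omega>" and y: "\<And>v. v \<in> C \<Longrightarrow> y + v \<in> \<Omega>"
    and xy: "dist x y \<le> s / 2"
  defines "\<kappa> \<equiv> campanato_const DIM('a) p E (cone_volume DIM('a) s)"
  shows "\<bar>f x - f y\<bar> \<le> (2 * (\<kappa> / (1 - 2 powr - \<gamma>)) + 2 * \<kappa>) * ((2 / s) powr \<gamma> * dist x y powr \<gamma> + h powr \<gamma>)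
     + 4 * (\<delta> / cone_volume DIM('a) s powr (1 / p))"
proof -
  obtain b where b: "ball b s \<subseteq> C" using C by (auto simp: cone_like_def)
  \<comment> \<open>The smallest admissible scale that guarantees that the ball around \<open>x + r b\<close> of radius \<open>r s / 2\<close>
    also lies in the cone at \<open>y\<close>.\<close>
  define r where "r = max (2 * dist x y / s) h"
  have "2 * dist x y / s \<le> r"
    by (simp add: r_def)
  then have "2 * dist x y \<le> r * s"
    using C by (simp add: pos_divide_le_eq)
  then have r: "h \<le> r" "r \<le> 1" "dist x y \<le> r * s / 2" "0 < r"
    using xy h C by (simp_all add: r_def)
  have "0 < r * s" using r C by simp
  have \<kappa>: "0 \<le> \<kappa>"
    by (simp add: \<kappa>_def campanato_const_nonneg)
  have g: "2 powr - \<gamma> < 1"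
    using \<gamma> by (simp add: powr_less_one)
  define A where "A = ball (x + r *\<^sub>R b) (r * s / 2)"
  have Ax: "A \<subseteq> cone_at C x r"
  proof -
    have "A \<subseteq> ball (x + r *\<^sub>R b) (r * s)"
      using \<open>0 < r * s\<close> by (auto simp: A_def)
    also have "\<dots> \<subseteq> cone_at C x r"
      by (intro cone_at_ball b r)
    finally show ?thesis .
  qed
  have Ay: "A \<subseteq> cone_at C y r"
  proof -
    have "A \<subseteq> ball (y + r *\<^sub>R b) (r * s)"
    proof
      fix z assume "z \<in> A"
      then have "dist (x + r *\<^sub>R b) z < r * s / 2"
        by (simp add: A_def)
      moreover have "dist (y + r *\<^sub>R b) (x + r *\<^sub>R b) = dist x y"
        by (simp add: dist_norm norm_minus_commute)
      ultimately show "z \<in> ball (y + r *\<^sub>R b) (r * s)"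
        using r(3) dist_triangle[of "y + r *\<^sub>R b" z "x + r *\<^sub>R b"] by simp
    qed
    also have "\<dots> \<subseteq> cone_at C y r"
      by (intro cone_at_ball b r)
    finally show ?thesis .
  qed
  have "\<bar>mean f (cone_at C x r) - mean f A\<bar> \<le> \<kappa> * r powr \<gamma>"
    unfolding \<kappa>_def using Ax r by (intro cone_mean_diff_le[OF C x]) (auto simp: A_def)
  moreover have "\<bar>mean f (cone_at C y r) - mean f A\<bar> \<le> \<kappa> * r powr \<gamma>"
    unfolding \<kappa>_def using Ay r by (intro cone_mean_diff_le[OF C y]) (auto simp: A_def)
  moreover note point_cone_mean_diff_le[OF C x r(1,2), folded \<kappa>_def] point_cone_mean_diff_le[OF C y r(1,2), folded \<kappa>_def]
  ultimately have "\<bar>f x - f y\<bar> \<le> 2 * (\<kappa> / (1 - 2 powr - \<gamma>) * r powr \<gamma>) + 2 * (\<kappa> * r powr \<gamma>)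
     + 4 * (\<delta> / cone_volume DIM('a) s powr (1 / p))"
    by linarith
  also have "\<dots> = (2 * (\<kappa> / (1 - 2 powr - \<gamma>)) + 2 * \<kappa>) * r powr \<gamma> + 4 * (\<delta> / cone_volume DIM('a) s powr (1 / p))"
    by (simp add: algebra_simps)
  also have "r powr \<gamma> \<le> (2 * dist x y / s) powr \<gamma> + h powr \<gamma>"
    by (simp add: r_def max_def)
  also have "(2 * dist x y / s) powr \<gamma> = (2 / s) powr \<gamma> * dist x y powr \<gamma>"
    using C powr_mult[of "2 / s" "dist x y" \<gamma>] by simp
  finally show ?thesis
    using \<kappa> g by (simp add: mult_left_mono)
qed

end

text \<open>
  Morrey's inequality down to scale \<open>h\<close>. Points closer than \<open>d\<close> share a cone; for the other pairs the
  bound on the values suffices, as \<open>dist x y powr \<gamma>\<close> is then bounded from below.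
\<close>

theorem nonlocal_morrey:
  fixes \<Omega> :: "'a::euclidean_space set"
  assumes cones: "uniform_cone_property \<delta>\<^sub>0 s \<Omega>" "0 < \<delta>\<^sub>0" "0 < s" and M: "0 < M"
  obtains L where "0 \<le> L"
    and "\<And>h \<delta> f x y. nonlocal_energy_bound \<Omega> p \<gamma> h E \<delta> M f \<Longrightarrow> x \<in> \<Omega> \<Longrightarrow> y \<in> \<Omega> \<Longrightarrow>
       \<bar>f x - f y\<bar> \<le> L * (dist x y powr \<gamma> + h powr \<gamma> + \<delta>)"
    and "\<And>h \<delta> f x. nonlocal_energy_bound \<Omega> p \<gamma> h E \<delta> M f \<Longrightarrow> x \<in> \<Omega> \<Longrightarrow> \<bar>f x\<bar> \<le> L * (1 + \<delta>)"
proof (cases "0 < \<gamma>")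
  case False
  have "\<not> nonlocal_energy_bound \<Omega> p \<gamma> h E \<delta> M f" for h \<delta> f
    using False nonlocal_energy_bound.\<gamma>(1)[of \<Omega> p \<gamma> h E \<delta> M f] by auto
  then show thesis
    using that[of 0] by auto
next
  case True
  define v where "v = cone_volume DIM('a) s powr (1 / p)"
  define \<kappa> where "\<kappa> = campanato_const DIM('a) p E (cone_volume DIM('a) s)"
  define D where "D = \<kappa> / (1 - 2 powr - \<gamma>)"
  define C where "C = D + 2 * (M / cone_volume DIM('a) s) powr (1 / p)"
  define d where "d = min \<delta>\<^sub>0 (s / 2)"
  define L where "L = (2 * D + 2 * \<kappa>) * (2 / s) powr \<gamma> + (2 * D + 2 * \<kappa>) + 4 / v + C + 2 * C / d powr \<gamma>"
  have d: "0 < d" using cones by (simp add: d_def)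
  have v: "0 < v" using cones(3) cone_volume_pos[of s "DIM('a)"] by (simp add: v_def)
  have \<kappa>: "0 \<le> \<kappa>" by (simp add: \<kappa>_def campanato_const_nonneg)
  have D: "0 \<le> D" using True \<kappa> by (simp add: D_def powr_less_one less_imp_le)
  have C: "0 \<le> C" using D by (simp add: C_def)
  have nn: "0 \<le> (2 * D + 2 * \<kappa>) * (2 / s) powr \<gamma>" "0 \<le> 2 * D + 2 * \<kappa>" "0 \<le> 4 / v" "0 \<le> 2 * C / d powr \<gamma>"
    using C D \<kappa> v by auto
  have L: "(2 * D + 2 * \<kappa>) * (2 / s) powr \<gamma> \<le> L" "2 * D + 2 * \<kappa> \<le> L" "4 / v \<le> L" "C \<le> L" "2 * C / d powr \<gamma> \<le> L"
    using C nn unfolding L_def by linarith+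
  have v2: "2 * (\<delta> / v) \<le> 4 / v * \<delta>" if "0 < \<delta>" for \<delta>
    using v that by (simp add: divide_right_mono)
  have bound: "\<bar>f x\<bar> \<le> C + 2 * (\<delta> / v)"
    if f: "nonlocal_energy_bound \<Omega> p \<gamma> h E \<delta> M f" and x: "x \<in> \<Omega>" for f h \<delta> x
  proof -
    interpret nonlocal_energy_bound \<Omega> p \<gamma> h E \<delta> M f by fact
    obtain K where "cone_like s K" "\<And>v. v \<in> K \<Longrightarrow> x + v \<in> \<Omega>"
      using cones x unfolding uniform_cone_property_def by (metis dist_self)
    from value_abs_le[OF this(1) cones(3) this(2)] show ?thesis
      by (simp add: C_def D_def \<kappa>_def v_def)
  qed
  show thesis
  proof (rule that[of L])
    show "0 \<le> L" using C L(4) by linarith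
  next
    fix h \<delta> f x
    assume f: "nonlocal_energy_bound \<Omega> p \<gamma> h E \<delta> M f" and x: "x \<in> \<Omega>"
    then have \<delta>: "0 < \<delta>"
      by (simp add: nonlocal_energy_bound_def)
    have "\<bar>f x\<bar> \<le> C * 1 + 4 / v * \<delta>"
      using bound[OF f x] v2[OF \<delta>] by simp
    also have "\<dots> \<le> L * 1 + L * \<delta>"
      using L \<delta> by (intro add_mono mult_right_mono) auto
    finally show "\<bar>f x\<bar> \<le> L * (1 + \<delta>)"
      by (simp add: algebra_simps)
  next
    fix h \<delta> f x y
    assume f: "nonlocal_energy_bound \<Omega> p \<gamma> h E \<delta> M f" and x: "x \<in> \<Omega>" and y: "y \<in> \<Omega>"
    then have \<delta>: "0 < \<delta>"
      by (simp add: nonlocal_energy_bound_def)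
    show "\<bar>f x - f y\<bar> \<le> L * (dist x y powr \<gamma> + h powr \<gamma> + \<delta>)"
    proof (cases "dist x y < d")
      case True
      then obtain K where K: "cone_like s K" "\<And>v. v \<in> K \<Longrightarrow> x + v \<in> \<Omega>" "\<And>v. v \<in> K \<Longrightarrow> y + v \<in> \<Omega>"
        using cones x y unfolding uniform_cone_property_def d_def by (metis min_less_iff_conj)
      have "\<bar>f x - f y\<bar> \<le> (2 * D + 2 * \<kappa>) * ((2 / s) powr \<gamma> * dist x y powr \<gamma> + h powr \<gamma>) + 4 * (\<delta> / v)"
        using nonlocal_energy_bound.close_diff_le[OF f K(1) cones(3) K(2,3)] True
        by (simp add: D_def \<kappa>_def v_def d_def)
      also have "\<dots> = (2 * D + 2 * \<kappa>) * (2 / s) powr \<gamma> * dist x y powr \<gamma> + (2 * D + 2 * \<kappa>) * h powr \<gamma>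
          + 4 / v * \<delta>"
        by (simp add: algebra_simps)
      also have "\<dots> \<le> L * dist x y powr \<gamma> + L * h powr \<gamma> + L * \<delta>"
        using L \<delta> by (intro add_mono mult_right_mono) auto
      finally show ?thesis
        by (simp add: algebra_simps)
    next
      case False
      have "d powr \<gamma> \<le> dist x y powr \<gamma>"
        using False True d by (intro powr_mono2) auto
      then have "2 * C / d powr \<gamma> * d powr \<gamma> \<le> 2 * C / d powr \<gamma> * dist x y powr \<gamma>"
        using nn by (intro mult_left_mono)
      then have "2 * C \<le> 2 * C / d powr \<gamma> * dist x y powr \<gamma>"
        using d by simp
      moreover have "\<bar>f x - f y\<bar> \<le> 2 * C + 4 * (\<delta> / v)"
        using bound[OF f x] bound[OF f y] by linarith
      ultimately have "\<bar>f x - f y\<bar> \<le> 2 * C / d powr \<gamma> * dist x y powr \<gamma> + 0 * h powr \<gamma> + 4 / v * \<delta>"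
        by simp
      also have "\<dots> \<le> L * dist x y powr \<gamma> + L * h powr \<gamma> + L * \<delta>"
        using L \<delta> nn by (intro add_mono mult_right_mono) auto
      finally show ?thesis
        by (simp add: algebra_simps)
    qed
  qed
qed

section \<open>Lipschitz domains have the uniform cone property\<close>

lemma cone_like_mono:
  assumes "cone_like s C" "s' \<le> s"
  shows "cone_like s' C"
  using assms subset_ball[of s' s] unfolding cone_like_def by (meson order_trans)

lemma cone_like_cball:
  assumes "0 < s" "s \<le> 1"
  shows "cone_like s (cball 0 s)"
  using assms by (auto simp: cone_like_def intro!: exI[of _ 0])

text \<open>
  This is the cone on which the vertical component dominates \<open>L\<close> times the horizontal one, so that
  moving inside it away from a point above the graph of an \<open>L\<close>-Lipschitz function stays above the graph.
  The inscribed ball has its centre \<open>(t / 2) e\<close> on the axis: within distance \<open>s\<close> of the centre, the vertical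
  component is at least \<open>t / 2 - s\<close> and the horizontal one at most \<open>2 s\<close>.
\<close>

lemma cone_like_circular_cone:
  fixes e :: "'a::euclidean_space"
  assumes e: "norm e = 1" and L: "0 \<le> L" and t: "0 < t" "t \<le> 1"
  shows "cone_like (t / (2 * (2 * L + 1))) ({v. L * norm (v - (v \<bullet> e) *\<^sub>R e) \<le> v \<bullet> e} \<inter> cball 0 t)"
    (is "cone_like ?s (?C \<inter> _)")
proof -
  define P where "P = (\<lambda>v. v - (v \<bullet> e) *\<^sub>R e)"
  have C: "?C = {v. L * norm (P v) \<le> v \<bullet> e}"
    by (simp add: P_def)
  have "closed ?C"
    by (intro closed_Collect_le continuous_intros)
  moreover have "convex ?C"
    unfolding C
  proof (rule convexI)
    fix v w a b
    assume v: "v \<in> {v. L * norm (P v) \<le> v \<bullet> e}" and w: "w \<in> {v. L * norm (P v) \<le> v \<bullet> e}"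
      and ab: "0 \<le> (a::real)" "0 \<le> b" "a + b = 1"
    have "P (a *\<^sub>R v + b *\<^sub>R w) = a *\<^sub>R P v + b *\<^sub>R P w"
      by (simp add: P_def algebra_simps inner_simps)
    then have "norm (P (a *\<^sub>R v + b *\<^sub>R w)) \<le> a * norm (P v) + b * norm (P w)"
      using norm_triangle_ineq[of "a *\<^sub>R P v" "b *\<^sub>R P w"] ab by simp
    then have "L * norm (P (a *\<^sub>R v + b *\<^sub>R w)) \<le> L * (a * norm (P v) + b * norm (P w))"
      using L by (rule mult_left_mono)
    also have "\<dots> = a * (L * norm (P v)) + b * (L * norm (P w))"
      by (simp add: algebra_simps)
    also have "\<dots> \<le> a * (v \<bullet> e) + b * (w \<bullet> e)"
      using v w ab by (intro add_mono mult_left_mono) auto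
    finally show "a *\<^sub>R v + b *\<^sub>R w \<in> {v. L * norm (P v) \<le> v \<bullet> e}"
      by (simp add: inner_simps)
  qed
  moreover have "ball ((t / 2) *\<^sub>R e) ?s \<subseteq> ?C \<inter> cball 0 t"
  proof
    fix v assume "v \<in> ball ((t / 2) *\<^sub>R e) ?s"
    define w where "w = v - (t / 2) *\<^sub>R e"
    have w: "norm w < ?s" and v: "v = w + (t / 2) *\<^sub>R e"
      using \<open>v \<in> _\<close> by (auto simp: w_def dist_norm norm_minus_commute)
    have ee: "e \<bullet> e = 1"
      using e by (simp add: dot_square_norm)
    have we: "\<bar>w \<bullet> e\<bar> \<le> norm w"
      using Cauchy_Schwarz_ineq2[of w e] e by simp
    have "P v = w - (w \<bullet> e) *\<^sub>R e"
      by (simp add: P_def v inner_simps ee algebra_simps)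
    then have Pv: "norm (P v) \<le> 2 * norm w"
      using norm_triangle_ineq4[of w "(w \<bullet> e) *\<^sub>R e"] we e by simp
    have s: "(2 * L + 1) * ?s = t / 2" "?s \<le> t / 2"
      using L t by (auto simp: field_simps)
    have "L * norm (P v) \<le> L * (2 * norm w)"
      using Pv L by (rule mult_left_mono)
    moreover have "(2 * L + 1) * norm w \<le> (2 * L + 1) * ?s"
      using w L by (intro mult_left_mono) auto
    ultimately have "L * norm (P v) \<le> t / 2 - norm w"
      unfolding s(1) by (simp add: algebra_simps)
    also have "\<dots> \<le> v \<bullet> e"
      using we by (simp add: v inner_simps ee)
    finally have "v \<in> ?C" by (simp add: C)
    moreover have "norm w < t / 2"
      using w s(2) by linarith
    then have "norm v \<le> t"
      using norm_triangle_ineq[of w "(t / 2) *\<^sub>R e"] e t unfolding v by simp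
    ultimately show "v \<in> ?C \<inter> cball 0 t" by simp
  qed
  ultimately show ?thesis
    using t L by (auto simp: cone_like_def convex_Int closed_Int_compact)
qed

text \<open>
  Around a point of \<open>\<Omega>\<close> a small ball serves as cone. Around a boundary point the circular cone about the vertical
  direction serves for all nearby points of \<open>\<Omega>\<close> alike.
\<close>

lemma lipschitz_boundary_local_cone:
  fixes \<Omega> :: "(real ^ 'd) set"
  assumes "open \<Omega>" "lipschitz_boundary \<Omega>" "z \<in> closure \<Omega>"
  shows "\<exists>R s C. 0 < R \<and> 0 < s \<and> cone_like s C \<and> (\<forall>x\<in>\<Omega> \<inter> ball z R. \<forall>v\<in>C. x + v \<in> \<Omega>)"
proof (cases "z \<in> \<Omega>")
  case True
  then obtain r where r: "0 < r" "ball z r \<subseteq> \<Omega>"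
    using assms by (auto simp: open_contains_ball)
  define t where "t = min 1 (r / 2)"
  have t: "0 < t" "t \<le> 1" "t \<le> r / 2" using r by (auto simp: t_def)
  have "x + v \<in> \<Omega>" if "x \<in> ball z (r / 2)" "v \<in> cball 0 t" for x v
  proof -
    have "dist z (x + v) < r"
      using that t dist_triangle[of z "x + v" x] by (simp add: dist_norm)
    then show ?thesis using r by auto
  qed
  then show ?thesis
    using r t cone_like_cball[of t] by (intro exI[of _ "r / 2"] exI[of _ t] exI[of _ "cball 0 t"]) auto
next
  case False
  then have "z \<in> frontier \<Omega>"
    using assms by (simp add: frontier_def interior_open)
  then obtain e g L r where e: "norm e = 1" and r: "0 < r" and g: "L-lipschitz_on {y. y \<bullet> e = 0} g"
    and \<Omega>: "\<Omega> \<inter> ball z r = {x \<in> ball z r. g (x - (x \<bullet> e) *\<^sub>R e) < x \<bullet> e}"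
    using bspec[OF assms(2)[unfolded lipschitz_boundary_def]] by blast
  define t where "t = min 1 (r / 2)"
  have t: "0 < t" "t \<le> 1" "t \<le> r / 2" using r by (auto simp: t_def)
  have L: "0 \<le> L" using g by (rule lipschitz_on_nonneg)
  define P where "P = (\<lambda>v. v - (v \<bullet> e) *\<^sub>R e)"
  have Pe: "P v \<bullet> e = 0" for v
    using e by (simp add: P_def inner_simps dot_square_norm)
  define C where "C = {v. L * norm (v - (v \<bullet> e) *\<^sub>R e) \<le> v \<bullet> e} \<inter> cball 0 t"
  have "x + v \<in> \<Omega>" if x: "x \<in> \<Omega>" "x \<in> ball z (r / 2)" and v: "v \<in> C" for x v
  proof -
    have 1: "x + v \<in> ball z r"
      using x v t dist_triangle[of z "x + v" x] by (simp add: dist_norm C_def)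
    have "x \<in> \<Omega> \<inter> ball z r"
      using x r by auto
    then have "g (P x) < x \<bullet> e"
      unfolding \<Omega> by (simp add: P_def)
    moreover have "\<bar>g (P (x + v)) - g (P x)\<bar> \<le> L * norm (P (x + v) - P x)"
      using lipschitz_onD[OF g, of "P (x + v)" "P x"] Pe by (simp add: dist_norm)
    moreover have "P (x + v) - P x = P v"
      by (simp add: P_def inner_simps algebra_simps)
    moreover have "L * norm (P v) \<le> v \<bullet> e"
      using v by (simp add: C_def P_def)
    ultimately have "g (P (x + v)) < (x + v) \<bullet> e"
      by (simp add: inner_simps)
    then have "x + v \<in> \<Omega> \<inter> ball z r"
      using 1 unfolding \<Omega> by (simp add: P_def)
    then show ?thesis by simp
  qed
  moreover have "cone_like (t / (2 * (2 * L + 1))) C" "0 < t / (2 * (2 * L + 1))"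
    using cone_like_circular_cone[OF e L t(1,2)] L t by (auto simp: C_def)
  ultimately show ?thesis
    using r by (intro exI[of _ "r / 2"] exI[of _ "t / (2 * (2 * L + 1))"] exI[of _ C]) auto
qed

text \<open>
  By compactness of the closure, finitely many of the local cones suffice. The margin between the
  balls of radius \<open>R z / 2\<close> that cover and the balls of radius \<open>R z\<close> on which the cone is admissible is what
  lets two nearby points share a cone.
\<close>

theorem lipschitz_boundary_uniform_cone:
  fixes \<Omega> :: "(real ^ 'd) set"
  assumes "open \<Omega>" "bounded \<Omega>" "lipschitz_boundary \<Omega>"
  obtains \<delta> s where "0 < \<delta>" "0 < s" "uniform_cone_property \<delta> s \<Omega>"
proof -
  have "\<forall>z\<in>closure \<Omega>. \<exists>R s C. 0 < R \<and> 0 < s \<and> cone_like s C \<and> (\<forall>x\<in>\<Omega> \<inter> ball z R. \<forall>v\<in>C. x + v \<in> \<Omega>)"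
    using lipschitz_boundary_local_cone assms by blast
  then obtain R s C where R: "\<And>z. z \<in> closure \<Omega> \<Longrightarrow> 0 < R z" and s: "\<And>z. z \<in> closure \<Omega> \<Longrightarrow> 0 < s z"
    and C: "\<And>z. z \<in> closure \<Omega> \<Longrightarrow> cone_like (s z) (C z)"
    and sub: "\<And>z x v. z \<in> closure \<Omega> \<Longrightarrow> x \<in> \<Omega> \<Longrightarrow> x \<in> ball z (R z) \<Longrightarrow> v \<in> C z \<Longrightarrow> x + v \<in> \<Omega>"
    by (metis IntI)
  have cpt: "compact (closure \<Omega>)"
    using assms by simp
  have cover: "closure \<Omega> \<subseteq> (\<Union>z\<in>closure \<Omega>. ball z (R z / 2))"
    using R by force
  obtain F where F: "F \<subseteq> closure \<Omega>" "finite F" "closure \<Omega> \<subseteq> (\<Union>z\<in>F. ball z (R z / 2))"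
    by (rule compactE_image[OF cpt _ cover]) auto
  define \<delta> where "\<delta> = Min (insert 1 ((\<lambda>z. R z / 2) ` F))"
  define \<sigma> where "\<sigma> = Min (insert 1 (s ` F))"
  have "0 < \<delta>" "0 < \<sigma>"
    using F R s by (auto simp: \<delta>_def \<sigma>_def)
  moreover have "uniform_cone_property \<delta> \<sigma> \<Omega>"
    unfolding uniform_cone_property_def
  proof (intro ballI impI)
    fix x y assume xy: "x \<in> \<Omega>" "y \<in> \<Omega>" "dist x y < \<delta>"
    obtain z where z: "z \<in> F" "x \<in> ball z (R z / 2)"
      using F(3) xy(1) closure_subset[of \<Omega>] by auto
    have z': "z \<in> closure \<Omega>" using z F by auto
    have "\<delta> \<le> R z / 2" "\<sigma> \<le> s z"
      unfolding \<delta>_def \<sigma>_def using F z by (intro Min_le; simp)+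
    then have "y \<in> ball z (R z)" "x \<in> ball z (R z)"
      using z xy R[OF z'] dist_triangle[of z y x] by auto
    then show "\<exists>C. cone_like \<sigma> C \<and> (\<forall>v\<in>C. x + v \<in> \<Omega> \<and> y + v \<in> \<Omega>)"
      using cone_like_mono[OF C[OF z'] \<open>\<sigma> \<le> s z\<close>] sub[OF z'] xy by (intro exI[of _ "C z"]) auto
  qed
  ultimately show thesis by (rule that)
qed

section \<open>From the graph energy to the nonlocal energy\<close>

text \<open>
  One level of the discretisation: a map \<open>T\<close> that transports \<open>\<mu>\<close> to the discrete measure \<open>\<nu>\<close>, where \<open>\<mu>\<close>
  dominates Lebesgue measure on \<open>\<Omega>\<close> up to the factor \<open>D\<close>. Sums over \<open>V\<close> weighted by \<open>\<nu>\<close> become integrals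
  over \<open>\<Omega>\<close>.
\<close>

locale transported_measure =
  fixes \<Omega> :: "(real ^ 'd) set" and \<rho> :: "real ^ 'd \<Rightarrow> real" and \<mu> :: "(real ^ 'd) measure"
    and V :: "(real ^ 'd) set" and \<nu> :: "(real ^ 'd) measure" and T :: "real ^ 'd \<Rightarrow> real ^ 'd" and D :: real
  assumes open_\<Omega>: "open \<Omega>" and \<rho>: "continuous_on \<Omega> \<rho>"
    and \<mu>: "\<mu> = density (restrict_space lborel \<Omega>) (\<lambda>x. ennreal (\<rho> x))"
    and V: "finite V"
    and \<nu>: "sets \<nu> = sets (restrict_space borel V)" "prob_space \<nu>"
    and T: "T \<in> restrict_space borel \<Omega> \<rightarrow>\<^sub>M restrict_space borel V" "distr \<mu> \<nu> T = \<nu>"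
    and D: "0 < D" "\<And>x. x \<in> \<Omega> \<Longrightarrow> 1 / D \<le> \<rho> x"
begin

sublocale \<nu>: prob_space \<nu> by (fact \<nu>)

lemma \<Omega>_sets[measurable]: "\<Omega> \<in> sets borel"
  using open_\<Omega> by simp

lemma sets_\<mu>[measurable_cong]: "sets \<mu> = sets (restrict_space borel \<Omega>)"
  by (simp add: \<mu> sets_restrict_space)

lemma space_\<mu>: "space \<mu> = \<Omega>"
  by (simp add: \<mu> space_restrict_space)

lemma sets_\<nu>: "sets \<nu> = Pow V"
proof -
  have "A \<in> sets (restrict_space borel V)" if "A \<subseteq> V" for A
  proof -
    have "A \<in> sets borel"
      using V that finite_subset[of A V] by (intro borel_closed finite_imp_closed) auto
    then show ?thesis
      using that by (auto simp: sets_restrict_space intro!: image_eqI[of _ _ A])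
  qed
  then show ?thesis
    unfolding \<nu> by (auto simp: sets_restrict_space)
qed

lemma space_\<nu>: "space \<nu> = V"
  using sets_eq_imp_space_eq[OF \<nu>(1)] by (simp add: space_restrict_space)

lemma measurable_\<nu>: "G \<in> borel_measurable \<nu>"
  by (subst measurable_cong_sets[of \<nu> "count_space V", OF _ refl]) (simp_all add: sets_\<nu>)

lemma T_measurable: "T \<in> \<mu> \<rightarrow>\<^sub>M \<nu>"
  using T(1) measurable_cong_sets[OF sets_\<mu> \<nu>(1)] by simp

lemma T_in_V: "x \<in> \<Omega> \<Longrightarrow> T x \<in> V"
  using measurable_space[OF T(1)] by (simp add: space_restrict_space)

lemma nn_integral_transport:
  fixes G :: "real ^ 'd \<Rightarrow> ennreal"
  shows "(\<integral>\<^sup>+x. G (T x) \<partial>\<mu>) = (\<Sum>x\<in>V. G x * ennreal (measure \<nu> {x}))"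
proof -
  have "(\<integral>\<^sup>+x. G (T x) \<partial>\<mu>) = (\<integral>\<^sup>+x. G x \<partial>distr \<mu> \<nu> T)"
    using measurable_\<nu>[of G] by (subst nn_integral_distr[OF T_measurable]) simp_all
  also have "\<dots> = (\<integral>\<^sup>+x. G x \<partial>\<nu>)"
    by (simp add: T)
  also have "\<dots> = (\<integral>\<^sup>+x. (\<Sum>y\<in>V. G y * indicator {y} x) \<partial>\<nu>)"
    using V by (intro nn_integral_cong) (simp add: space_\<nu> indicator_def)
  also have "\<dots> = (\<Sum>y\<in>V. \<integral>\<^sup>+x. G y * indicator {y} x \<partial>\<nu>)"
    by (intro nn_integral_sum measurable_\<nu>)
  also have "\<dots> = (\<Sum>x\<in>V. G x * ennreal (measure \<nu> {x}))"
    by (intro sum.cong refl) (simp add: nn_integral_cmult_indicator sets_\<nu> \<nu>.emeasure_eq_measure)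
  finally show ?thesis .
qed

lemma nn_integral_lborel_le:
  fixes H :: "real ^ 'd \<Rightarrow> ennreal"
  assumes H: "H \<in> borel_measurable (restrict_space borel \<Omega>)"
  shows "(\<integral>\<^sup>+y. H y * indicator \<Omega> y \<partial>lborel) \<le> ennreal D * (\<integral>\<^sup>+y. H y \<partial>\<mu>)"
proof -
  let ?R = "restrict_space lborel \<Omega>"
  have sets: "sets ?R = sets (restrict_space borel \<Omega>)"
    by (simp add: sets_restrict_space)
  have H': "H \<in> borel_measurable ?R"
    using H measurable_cong_sets[OF sets refl] by blast
  have \<rho>': "\<rho> \<in> borel_measurable ?R"
    using borel_measurable_continuous_on_restrict[OF \<rho>] measurable_cong_sets[OF sets refl] by blast
  have "(\<integral>\<^sup>+y. H y * indicator \<Omega> y \<partial>lborel) = (\<integral>\<^sup>+y. H y \<partial>?R)"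
    by (subst nn_integral_restrict_space) auto
  also have "\<dots> \<le> (\<integral>\<^sup>+y. ennreal D * (ennreal (\<rho> y) * H y) \<partial>?R)"
  proof (intro nn_integral_mono)
    fix y assume "y \<in> space ?R"
    then have "1 \<le> D * \<rho> y"
      using D(2)[of y] D(1) by (simp add: space_restrict_space field_simps)
    then have "1 \<le> ennreal D * ennreal (\<rho> y)"
      using D(1) by (subst ennreal_mult'[symmetric]) (auto simp: ennreal_1[symmetric] simp del: ennreal_1 intro!: ennreal_leI)
    then have "1 * H y \<le> ennreal D * ennreal (\<rho> y) * H y"
      by (rule mult_right_mono) simp
    then show "H y \<le> ennreal D * (ennreal (\<rho> y) * H y)"
      by (simp add: mult.assoc)
  qed
  also have "\<dots> = ennreal D * (\<integral>\<^sup>+y. ennreal (\<rho> y) * H y \<partial>?R)"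
    using \<rho>' H' by (intro nn_integral_cmult borel_measurable_times_ennreal measurable_compose[OF \<rho>' measurable_ennreal])
  also have "(\<integral>\<^sup>+y. ennreal (\<rho> y) * H y \<partial>?R) = (\<integral>\<^sup>+y. H y \<partial>\<mu>)"
    unfolding \<mu> using \<rho>' H' by (intro nn_integral_density[symmetric]) auto
  finally show ?thesis .
qed

lemma transported_measurable: "(\<lambda>y. G (T y)) \<in> borel_measurable (restrict_space borel \<Omega>)"
  using measurable_comp[OF T_measurable measurable_\<nu>[of G]] measurable_cong_sets[OF sets_\<mu> refl]
  by (simp add: comp_def)

text \<open>
  For \<open>y\<close> and \<open>z\<close> at distance at most \<open>2 h = c \<epsilon> / 2\<close>, the images \<open>T y\<close> and \<open>T z\<close> are at distance at most
  \<open>(c / 2 + 2 K) \<epsilon> \<le> c \<epsilon>\<close>, where the non-increasing kernel is at least \<open>\<eta> c\<close>. Hence the graph energy bounds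
  the nonlocal energy of \<open>u \<circ> T\<close>. The oscillation around a single point \<open>x\<close> comes from the contribution of
  the vertex \<open>T x\<close> to the energy, divided by the mass of that vertex, which is at least \<open>m\<close>.
\<close>

lemma transported_energy_bound:
  fixes u :: "real ^ 'd \<Rightarrow> real" and p \<epsilon> K c G N m :: real
  assumes p: "real CARD('d) < p" and \<epsilon>: "0 < \<epsilon>"
    and K: "\<And>x. x \<in> \<Omega> \<Longrightarrow> norm (T x - x) \<le> K * \<epsilon>" and Kc: "4 * K \<le> c"
    and c: "0 < c" "c / 4 * \<epsilon> \<le> 1"
    and \<eta>: "antimono_on {0..} \<eta>" "\<And>r. 0 \<le> r \<Longrightarrow> 0 \<le> \<eta> r" "0 < \<eta> c"
    and G: "graph_energy \<eta> p \<epsilon> V \<nu> u \<le> G" "0 < G"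
    and N: "graph_Lp_norm p V \<nu> u \<le> N" "0 < N"
    and m: "0 < m" "\<And>x. x \<in> V \<Longrightarrow> m \<le> measure \<nu> {x}"
  shows "nonlocal_energy_bound \<Omega> p (1 - CARD('d) / p) (c / 4 * \<epsilon>) (D\<^sup>2 * G / \<eta> c * (4 / c) powr (p + CARD('d)))
    ((D * G / \<eta> c * (4 / c) ^ CARD('d) * (\<epsilon> powr p / m)) powr (1 / p)) (D * N powr p)
    (\<lambda>x. if x \<in> \<Omega> then u (T x) else 0)"
proof -
  define d where "d = CARD('d)"
  define f where "f = (\<lambda>x. if x \<in> \<Omega> then u (T x) else 0)"
  define h where "h = c / 4 * \<epsilon>"
  \<comment> \<open>Lower bound for the scaled kernel on the pairs of vertices that occur.\<close>
  define q where "q = \<eta> c / \<epsilon> ^ d"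
  define F where "F = (\<lambda>x y. scaled_kernel d \<eta> \<epsilon> (norm (x - y)) * \<bar>u x - u y\<bar> powr p)"
  \<comment> \<open>Contribution of the vertex \<open>x\<close> to the energy, up to the factors \<open>\<epsilon> powr p\<close> and mass of \<open>x\<close>.\<close>
  define W where "W = (\<lambda>x. \<Sum>y\<in>V. ennreal (F x y) * ennreal (measure \<nu> {y}))"
  have q: "0 < q" using \<eta> \<epsilon> by (simp add: q_def)
  have p0: "0 < p" using p by (meson le_less_trans of_nat_0_le_iff)
  have cancel: "x = (x powr (1 / p)) powr p" if "0 < x" for x
    using p0 that by (simp add: powr_powr)
  have h: "0 < h" "h \<le> 1" using c \<epsilon> by (auto simp: h_def)
  have F0: "0 \<le> F x y" for x y
    using \<eta>(2) \<epsilon> by (simp add: F_def scaled_kernel_def)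
  have W_eq: "W x = ennreal (\<Sum>y\<in>V. F x y * measure \<nu> {y})" for x
    using F0 by (simp add: W_def sum_ennreal flip: ennreal_mult)
  have f\<Omega>: "f x = u (T x)" if "x \<in> \<Omega>" for x
    using that by (simp add: f_def)
  have f_meas: "f \<in> borel_measurable borel"
    unfolding f_def using transported_measurable[of u]
    by (intro measurable_If_restrict_space_iff[THEN iffD2]) (auto simp: \<Omega>_sets)
  have W_int: "(\<integral>\<^sup>+x. W (T x) \<partial>\<mu>) = ennreal (\<epsilon> powr p * graph_energy \<eta> p \<epsilon> V \<nu> u)"
  proof -
    have "(\<integral>\<^sup>+x. W (T x) \<partial>\<mu>) = ennreal (\<Sum>x\<in>V. (\<Sum>y\<in>V. F x y * measure \<nu> {y}) * measure \<nu> {x})"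
      unfolding nn_integral_transport[of W] unfolding W_eq
      using F0 by (simp add: sum_ennreal sum_nonneg flip: ennreal_mult)
    also have "(\<Sum>x\<in>V. (\<Sum>y\<in>V. F x y * measure \<nu> {y}) * measure \<nu> {x}) = \<epsilon> powr p * graph_energy \<eta> p \<epsilon> V \<nu> u"
      using \<epsilon> by (simp add: graph_energy_def F_def d_def sum_distrib_left sum_distrib_right mult_ac)
    finally show ?thesis .
  qed
  have W_le: "(\<integral>\<^sup>+x. W (T x) \<partial>\<mu>) \<le> ennreal (\<epsilon> powr p * G)"
    unfolding W_int using G by (intro ennreal_leI mult_left_mono) auto
  have W_point: "W (T x) \<le> ennreal (\<epsilon> powr p * G / m)" if "x \<in> \<Omega>" for x
  proof -
    define S where "S = (\<lambda>x. \<Sum>y\<in>V. F x y * measure \<nu> {y})"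
    have S: "0 \<le> S z" for z
      using F0 by (simp add: S_def sum_nonneg)
    have W_S: "W x = ennreal (S x)" for x
      by (simp add: W_eq S_def)
    have z: "T x \<in> V" using that by (rule T_in_V)
    have "ennreal (\<Sum>x\<in>V. S x * measure \<nu> {x}) = (\<integral>\<^sup>+x. W (T x) \<partial>\<mu>)"
      unfolding nn_integral_transport[of W] unfolding W_S
      using S by (simp add: sum_ennreal flip: ennreal_mult)
    then have "ennreal (\<Sum>x\<in>V. S x * measure \<nu> {x}) \<le> ennreal (\<epsilon> powr p * G)"
      using W_le by simp
    then have le: "(\<Sum>x\<in>V. S x * measure \<nu> {x}) \<le> \<epsilon> powr p * G"
      using G by (subst (asm) ennreal_le_iff) auto
    have "m * S (T x) \<le> S (T x) * measure \<nu> {T x}"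
      using mult_right_mono[OF m(2)[OF z] S[of "T x"]] by (simp add: mult.commute)
    also have "\<dots> \<le> (\<Sum>x\<in>V. S x * measure \<nu> {x})"
      using z V S by (intro member_le_sum) auto
    also note le
    finally have "S (T x) \<le> \<epsilon> powr p * G / m"
      using m by (simp add: field_simps)
    then show ?thesis
      unfolding W_eq S_def by (rule ennreal_leI)
  qed
  have inner: "(\<integral>\<^sup>+z. ennreal (\<bar>f y - f z\<bar> powr p) * indicator \<Omega> z * indicator {..2 * h} (norm (z - y)) \<partial>lborel)
      \<le> ennreal (D / q) * W (T y)" if y: "y \<in> \<Omega>" for y
  proof -
    have "(\<integral>\<^sup>+z. ennreal (\<bar>f y - f z\<bar> powr p) * indicator \<Omega> z * indicator {..2 * h} (norm (z - y)) \<partial>lborel)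
      \<le> (\<integral>\<^sup>+z. (ennreal (1 / q) * ennreal (F (T y) (T z))) * indicator \<Omega> z \<partial>lborel)"
    proof (intro nn_integral_mono)
      fix z
      show "ennreal (\<bar>f y - f z\<bar> powr p) * indicator \<Omega> z * indicator {..2 * h} (norm (z - y))
        \<le> ennreal (1 / q) * ennreal (F (T y) (T z)) * indicator \<Omega> z"
      proof (cases "z \<in> \<Omega> \<and> norm (z - y) \<le> 2 * h")
        case True
        have "norm (T y - T z) \<le> norm (T y - y) + norm (T z - z) + norm (z - y)"
          using norm_triangle_ineq4[of "T y - y" "T z - z"] norm_triangle_ineq4[of "T y - y - (T z - z)" "z - y"]
          by (simp add: algebra_simps)
        also have "\<dots> \<le> K * \<epsilon> + K * \<epsilon> + 2 * h"
          using K[of y] K[of z] True y by (intro add_mono) auto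
        also have "\<dots> = (4 * K + c) * \<epsilon> / 2"
          by (simp add: h_def algebra_simps)
        also have "\<dots> \<le> (2 * c) * \<epsilon> / 2"
          using Kc \<epsilon> by (intro divide_right_mono mult_right_mono) auto
        finally have "norm (T y - T z) / \<epsilon> \<le> c"
          using \<epsilon> by (simp add: field_simps)
        then have "\<eta> c \<le> \<eta> (norm (T y - T z) / \<epsilon>)"
          using \<eta>(1) \<epsilon> c by (auto simp: monotone_on_def)
        then have "q \<le> scaled_kernel d \<eta> \<epsilon> (norm (T y - T z))"
          using \<epsilon> by (simp add: q_def scaled_kernel_def divide_right_mono)
        then have "q * \<bar>f y - f z\<bar> powr p \<le> F (T y) (T z)"
          using True y by (simp add: F_def f\<Omega> mult_right_mono)
        then have "\<bar>f y - f z\<bar> powr p \<le> 1 / q * F (T y) (T z)"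
          using q by (simp add: field_simps)
        then show ?thesis
          using True q F0 by (simp add: ennreal_leI flip: ennreal_mult)
      qed (auto simp: indicator_def)
    qed
    also have "\<dots> \<le> ennreal D * (\<integral>\<^sup>+z. ennreal (1 / q) * ennreal (F (T y) (T z)) \<partial>\<mu>)"
      using transported_measurable[of "\<lambda>z. ennreal (1 / q) * ennreal (F (T y) z)"]
      by (intro nn_integral_lborel_le)
    also have "(\<integral>\<^sup>+z. ennreal (1 / q) * ennreal (F (T y) (T z)) \<partial>\<mu>) = ennreal (1 / q) * W (T y)"
      unfolding nn_integral_transport[of "\<lambda>z. ennreal (1 / q) * ennreal (F (T y) z)"] W_def
      by (simp add: sum_distrib_left mult.assoc)
    also have "ennreal D * (ennreal (1 / q) * W (T y)) = ennreal (D / q) * W (T y)"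
      using D q by (simp add: mult.assoc[symmetric] flip: ennreal_mult)
    finally show ?thesis .
  qed
  have "nonlocal_energy_bound \<Omega> p (1 - CARD('d) / p) h (D\<^sup>2 * G / \<eta> c * (4 / c) powr (p + CARD('d)))
    ((D * G / \<eta> c * (4 / c) ^ CARD('d) * (\<epsilon> powr p / m)) powr (1 / p)) (D * N powr p) f"
  proof
    show "f \<in> borel_measurable borel" by (rule f_meas)
    have "range f \<subseteq> insert 0 (u ` V)"
      using T_in_V by (auto simp: f_def)
    then show "bounded (range f)"
      using V by (meson bounded_subset finite_imp_bounded finite_imageI finite_insert)
    show "0 < D\<^sup>2 * G / \<eta> c * (4 / c) powr (p + CARD('d))"
      using D G \<eta> c by simp
    have B: "0 < D * G / \<eta> c * (4 / c) ^ CARD('d) * (\<epsilon> powr p / m)"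
      using D G \<eta> c \<epsilon> m by simp
    then show "0 < (D * G / \<eta> c * (4 / c) ^ CARD('d) * (\<epsilon> powr p / m)) powr (1 / p)"
      by (metis powr_gt_zero less_irrefl)
    show "0 < D * N powr p" using D N by simp
    show "real DIM(real ^ 'd) < p" using p by simp
    show "1 - CARD('d) / p = 1 - real DIM(real ^ 'd) / p" by simp
    show "0 < h" "h \<le> 1" by fact+
    show "(\<integral>\<^sup>+y. \<integral>\<^sup>+z. ennreal (\<bar>f y - f z\<bar> powr p) * indicator (\<Omega> \<times> \<Omega>) (y, z) *
          indicator {..h} (norm (z - y)) \<partial>lborel \<partial>lborel)
        \<le> ennreal (D\<^sup>2 * G / \<eta> c * (4 / c) powr (p + CARD('d)) * h powr (p + DIM(real ^ 'd)))"
    proof -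
      have "(\<integral>\<^sup>+y. \<integral>\<^sup>+z. ennreal (\<bar>f y - f z\<bar> powr p) * indicator (\<Omega> \<times> \<Omega>) (y, z) *
          indicator {..h} (norm (z - y)) \<partial>lborel \<partial>lborel)
        \<le> (\<integral>\<^sup>+y. ennreal (D / q) * W (T y) * indicator \<Omega> y \<partial>lborel)"
      proof (rule nn_integral_mono)
        fix y
        show "(\<integral>\<^sup>+z. ennreal (\<bar>f y - f z\<bar> powr p) * indicator (\<Omega> \<times> \<Omega>) (y, z) *
          indicator {..h} (norm (z - y)) \<partial>lborel) \<le> ennreal (D / q) * W (T y) * indicator \<Omega> y"
        proof (cases "y \<in> \<Omega>")
          case True
          have "(\<integral>\<^sup>+z. ennreal (\<bar>f y - f z\<bar> powr p) * indicator (\<Omega> \<times> \<Omega>) (y, z) * indicator {..h} (norm (z - y)) \<partial>lborel)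
            \<le> (\<integral>\<^sup>+z. ennreal (\<bar>f y - f z\<bar> powr p) * indicator \<Omega> z * indicator {..2 * h} (norm (z - y)) \<partial>lborel)"
            using h by (intro nn_integral_mono) (auto simp: indicator_def)
          also have "\<dots> \<le> ennreal (D / q) * W (T y)" by (rule inner[OF True])
          finally show ?thesis using True by simp
        qed simp
      qed
      also have "\<dots> \<le> ennreal D * (\<integral>\<^sup>+y. ennreal (D / q) * W (T y) \<partial>\<mu>)"
        using transported_measurable[of "\<lambda>y. ennreal (D / q) * W y"] by (intro nn_integral_lborel_le)
      also have "(\<integral>\<^sup>+y. ennreal (D / q) * W (T y) \<partial>\<mu>) = ennreal (D / q) * (\<integral>\<^sup>+y. W (T y) \<partial>\<mu>)"
        using measurable_comp[OF T_measurable measurable_\<nu>[of W]]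
            by (intro nn_integral_cmult) (simp add: comp_def)
      also have "ennreal D * (ennreal (D / q) * (\<integral>\<^sup>+y. W (T y) \<partial>\<mu>))
          \<le> ennreal D * (ennreal (D / q) * ennreal (\<epsilon> powr p * G))"
        by (intro mult_left_mono W_le) auto
      also have "\<dots> = ennreal (D * (D / q * (\<epsilon> powr p * G)))"
        using D q G by (simp flip: ennreal_mult)
      also have "D * (D / q * (\<epsilon> powr p * G)) = D\<^sup>2 * G / \<eta> c * \<epsilon> powr (p + CARD('d))"
        using \<epsilon> by (simp add: q_def d_def powr_add powr_realpow power2_eq_square)
      also have "\<epsilon> powr (p + CARD('d)) = (4 / c) powr (p + CARD('d)) * h powr (p + CARD('d))"
        using h c by (subst powr_mult[symmetric]) (auto simp: h_def)
      finally show ?thesis by (simp add: mult.assoc)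
    qed
    show "(\<integral>\<^sup>+y. ennreal (\<bar>f x - f y\<bar> powr p) * indicator \<Omega> y * indicator {..2 * h} (norm (y - x)) \<partial>lborel)
      \<le> ennreal (((D * G / \<eta> c * (4 / c) ^ CARD('d) * (\<epsilon> powr p / m)) powr (1 / p)) powr p * h ^ DIM(real ^ 'd))"
      if "x \<in> \<Omega>" for x
    proof -
      note inner[OF that]
      also have "ennreal (D / q) * W (T x) \<le> ennreal (D / q) * ennreal (\<epsilon> powr p * G / m)"
        by (intro mult_left_mono W_point that) auto
      also have "\<dots> = ennreal (D / q * (\<epsilon> powr p * G / m))"
        using D q G m by (simp flip: ennreal_mult)
      also have "D / q * (\<epsilon> powr p * G / m) = (D * G / \<eta> c * (4 / c) ^ CARD('d) * (\<epsilon> powr p / m)) * h ^ CARD('d)"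
        using c by (simp add: q_def d_def h_def power_mult_distrib power_divide)
      also have "(D * G / \<eta> c * (4 / c) ^ CARD('d) * (\<epsilon> powr p / m)) =
          ((D * G / \<eta> c * (4 / c) ^ CARD('d) * (\<epsilon> powr p / m)) powr (1 / p)) powr p"
        by (rule cancel[OF B])
      finally show ?thesis by simp
    qed
    show "(\<integral>\<^sup>+y. ennreal (\<bar>f y\<bar> powr p) * indicator \<Omega> y \<partial>lborel) \<le> ennreal (D * N powr p)"
    proof -
      have "(\<integral>\<^sup>+y. ennreal (\<bar>f y\<bar> powr p) * indicator \<Omega> y \<partial>lborel)
          = (\<integral>\<^sup>+y. ennreal (\<bar>u (T y)\<bar> powr p) * indicator \<Omega> y \<partial>lborel)"
        by (intro nn_integral_cong) (auto simp: indicator_def f_def)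
      also have "\<dots> \<le> ennreal D * (\<integral>\<^sup>+y. ennreal (\<bar>u (T y)\<bar> powr p) \<partial>\<mu>)"
        using transported_measurable[of "\<lambda>y. ennreal (\<bar>u y\<bar> powr p)"] by (intro nn_integral_lborel_le)
      also have "(\<integral>\<^sup>+y. ennreal (\<bar>u (T y)\<bar> powr p) \<partial>\<mu>) = ennreal (\<Sum>x\<in>V. \<bar>u x\<bar> powr p * measure \<nu> {x})"
        unfolding nn_integral_transport[of "\<lambda>y. ennreal (\<bar>u y\<bar> powr p)"]
            by (simp add: sum_ennreal flip: ennreal_mult)
      also have "(\<Sum>x\<in>V. \<bar>u x\<bar> powr p * measure \<nu> {x}) = graph_Lp_norm p V \<nu> u powr p"
        using p0 by (simp add: graph_Lp_norm_def powr_powr sum_nonneg)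
      also have "ennreal D * ennreal \<dots> \<le> ennreal D * ennreal (N powr p)"
        using N p0 by (intro mult_left_mono ennreal_leI powr_mono2) (auto simp: graph_Lp_norm_def)
      also have "\<dots> = ennreal (D * N powr p)"
        using D by (simp flip: ennreal_mult)
      finally show ?thesis .
    qed
  qed
  then show ?thesis
    by (simp add: f_def[abs_def] h_def)
qed

end

section \<open>Compactness of approximately Hoelder continuous functions\<close>

text \<open>
  The function \<open>t \<mapsto> t powr \<gamma>\<close> dominates the identity on the unit interval; apply this to the fractions
  \<open>a / (a + b)\<close> and \<open>b / (a + b)\<close>.
\<close>

lemma powr_add_le:
  fixes a b \<gamma> :: real
  assumes "0 \<le> a" "0 \<le> b" "0 < \<gamma>" "\<gamma> \<le> 1"
  shows "(a + b) powr \<gamma> \<le> a powr \<gamma> + b powr \<gamma>"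
proof (cases "a + b = 0")
  case False
  then have ab: "0 < a + b" using assms by simp
  have le: "t * (a + b) powr \<gamma> \<le> (t * (a + b)) powr \<gamma>" if "0 \<le> t" "t \<le> 1" for t
  proof -
    have "t powr 1 \<le> t powr \<gamma>"
      using that assms by (intro powr_mono') auto
    then show ?thesis
      using that ab by (simp add: powr_mult mult_right_mono)
  qed
  have "(a + b) powr \<gamma> = a / (a + b) * (a + b) powr \<gamma> + b / (a + b) * (a + b) powr \<gamma>"
    using ab by (simp add: distrib_right[symmetric] add_divide_distrib[symmetric])
  also have "\<dots> \<le> a powr \<gamma> + b powr \<gamma>"
    using le[of "a / (a + b)"] le[of "b / (a + b)"] ab assms by (intro add_mono) auto
  finally show ?thesis .
qed (use assms in auto)

text \<open>
  The functions \<open>f n\<close> may be discontinuous, so that the theorem of Arzela and Ascoli does not apply to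
  them. McShane's formula \<open>w n x = (INF y\<in>\<Omega>. f n y + L * dist x y powr \<gamma>)\<close> replaces them by Hoelder
  functions with constant \<open>L\<close>, defined on the closure as well, and moves the values on \<open>\<Omega>\<close> by at most \<open>\<delta> n\<close>.
\<close>

lemma quasi_holder_subsequence:
  fixes f :: "nat \<Rightarrow> 'a::euclidean_space \<Rightarrow> real"
  assumes \<Omega>: "bounded \<Omega>" "\<Omega> \<noteq> {}" and \<gamma>: "0 < \<gamma>" "\<gamma> \<le> 1" and L: "0 \<le> L"
    and f: "\<And>n x y. x \<in> \<Omega> \<Longrightarrow> y \<in> \<Omega> \<Longrightarrow> \<bar>f n x - f n y\<bar> \<le> L * dist x y powr \<gamma> + \<delta> n"
    and M: "\<And>n x. x \<in> \<Omega> \<Longrightarrow> \<bar>f n x\<bar> \<le> M"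
    and \<delta>: "\<delta> \<longlonglongrightarrow> 0"
  obtains \<phi> u where "strict_mono (\<phi> :: nat \<Rightarrow> nat)" "u \<in> holder_space \<gamma> (closure \<Omega>)"
    "(\<lambda>k. SUP x\<in>\<Omega>. \<bar>f (\<phi> k) x - u x\<bar>) \<longlonglongrightarrow> 0"
proof -
  define w where "w = (\<lambda>n x. INF y\<in>\<Omega>. f n y + L * dist x y powr \<gamma>)"
  have low: "- M \<le> f n y + L * dist x y powr \<gamma>" if "y \<in> \<Omega>" for n x y
    using M[OF that, of n] L by (smt (verit) mult_nonneg_nonneg powr_ge_zero)
  have bdd: "bdd_below ((\<lambda>y. f n y + L * dist x y powr \<gamma>) ` \<Omega>)" for n x
    using low by (intro bdd_belowI2[of _ "- M"]) auto
  have w_le: "w n x \<le> f n y + L * dist x y powr \<gamma>" if "y \<in> \<Omega>" for n x y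
    unfolding w_def by (rule cINF_lower[OF bdd that])
  have le_w: "a \<le> w n x" if "\<And>y. y \<in> \<Omega> \<Longrightarrow> a \<le> f n y + L * dist x y powr \<gamma>" for a n x
    unfolding w_def using that \<Omega> by (intro cINF_greatest) auto
  have w_f: "\<bar>w n x - f n x\<bar> \<le> \<delta> n" if x: "x \<in> \<Omega>" for n x
  proof -
    have "w n x \<le> f n x"
      using w_le[OF x, of n x] by simp
    moreover have "f n x - \<delta> n \<le> w n x"
    proof (rule le_w)
      fix y assume "y \<in> \<Omega>"
      then show "f n x - \<delta> n \<le> f n y + L * dist x y powr \<gamma>"
        using f[OF x, of y n] by linarith
    qed
    ultimately show ?thesis by linarith
  qed
  have w_half: "w n x' - L * dist x x' powr \<gamma> \<le> w n x" for n x x'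
  proof (rule le_w)
    fix y assume y: "y \<in> \<Omega>"
    have "dist x' y powr \<gamma> \<le> (dist x x' + dist x y) powr \<gamma>"
      using \<gamma> dist_triangle[of x' y x] by (intro powr_mono2) (auto simp: dist_commute)
    also have "\<dots> \<le> dist x x' powr \<gamma> + dist x y powr \<gamma>"
      using \<gamma> by (intro powr_add_le) auto
    finally have "L * dist x' y powr \<gamma> \<le> L * (dist x x' powr \<gamma> + dist x y powr \<gamma>)"
      using L by (rule mult_left_mono)
    then show "w n x' - L * dist x x' powr \<gamma> \<le> f n y + L * dist x y powr \<gamma>"
      using w_le[OF y, of n x'] by (simp add: distrib_left)
  qed
  have w_holder: "\<bar>w n x - w n y\<bar> \<le> L * dist x y powr \<gamma>" for n x y
    using w_half[of n x y] w_half[of n y x] by (simp add: dist_commute abs_le_iff)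
  obtain y0 where y0: "y0 \<in> \<Omega>" using \<Omega> by auto
  obtain B where B: "\<And>x. x \<in> closure \<Omega> \<Longrightarrow> dist y0 x \<le> B"
    using bounded_closure[OF \<Omega>(1)] bounded_any_center[of "closure \<Omega>" y0] by auto
  have w_bound: "norm (w n x) \<le> M + L * B powr \<gamma>" if x: "x \<in> closure \<Omega>" for n x
  proof -
    have "- M \<le> w n x"
      by (rule le_w) (rule low)
    moreover have "L * dist x y0 powr \<gamma> \<le> L * B powr \<gamma>"
      using B[OF x] \<gamma> L by (intro mult_left_mono powr_mono2) (auto simp: dist_commute)
    moreover have "0 \<le> L * B powr \<gamma>"
      using L by simp
    ultimately show ?thesis
      using w_le[OF y0, of n x] M[OF y0, of n] by (simp add: abs_le_iff)
  qed
  have equi: "\<exists>d>0. \<forall>n y. y \<in> closure \<Omega> \<and> norm (x - y) < d \<longrightarrow> norm (w n x - w n y) < e"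
    if e: "0 < e" for x e
  proof -
    define d where "d = (e / (L + 1)) powr (1 / \<gamma>)"
    have "0 < e / (L + 1)" using e L by simp
    then have d: "0 < d" "d powr \<gamma> = e / (L + 1)"
      using \<gamma> e L by (auto simp: d_def powr_powr)
    have "\<bar>w n x - w n y\<bar> < e" if "dist x y < d" for n y
    proof -
      have "L * dist x y powr \<gamma> \<le> L * d powr \<gamma>"
        using that \<gamma> L by (intro mult_left_mono powr_mono2) auto
      also have "\<dots> < e"
        using e L by (simp add: d field_simps)
      finally show ?thesis
        using w_holder[of n x y] by linarith
    qed
    then show ?thesis
      using d by (intro exI[of _ d]) (auto simp: dist_norm)
  qed
  obtain u \<phi> where \<phi>: "strict_mono (\<phi> :: nat \<Rightarrow> nat)"
    and u: "\<And>e. 0 < e \<Longrightarrow> \<exists>N. \<forall>n x. n \<ge> N \<and> x \<in> closure \<Omega> \<longrightarrow> norm (w (\<phi> n) x - u x) < e"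
    by (rule Arzela_Ascoli[of "closure \<Omega>" w "M + L * B powr \<gamma>"])
       (use \<Omega> w_bound equi in \<open>auto\<close>)
  have "\<bar>u x - u y\<bar> \<le> L * dist x y powr \<gamma>" if xy: "x \<in> closure \<Omega>" "y \<in> closure \<Omega>" for x y
  proof (rule field_le_epsilon)
    fix e :: real assume "0 < e"
    then obtain N where "\<And>n x. n \<ge> N \<and> x \<in> closure \<Omega> \<Longrightarrow> norm (w (\<phi> n) x - u x) < e / 2"
      using u[of "e / 2"] by auto
    from this[of N x] this[of N y] xy
    have "\<bar>w (\<phi> N) x - u x\<bar> < e / 2" "\<bar>w (\<phi> N) y - u y\<bar> < e / 2"
      by auto
    then show "\<bar>u x - u y\<bar> \<le> L * dist x y powr \<gamma> + e"
      using w_holder[of "\<phi> N" x y] by linarith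
  qed
  then have holder: "u \<in> holder_space \<gamma> (closure \<Omega>)"
    unfolding holder_space_def by blast
  have "(\<lambda>k. SUP x\<in>\<Omega>. \<bar>f (\<phi> k) x - u x\<bar>) \<longlonglongrightarrow> 0"
  proof (rule LIMSEQ_I)
    fix e :: real assume e: "0 < e"
    then obtain N where N: "\<And>n x. n \<ge> N \<and> x \<in> closure \<Omega> \<Longrightarrow> norm (w (\<phi> n) x - u x) < e / 3"
      using u[of "e / 3"] by auto
    have "(\<lambda>k. \<delta> (\<phi> k)) \<longlonglongrightarrow> 0"
      using LIMSEQ_subseq_LIMSEQ[OF \<delta> \<phi>] by (simp add: comp_def)
    then obtain N' where N': "\<And>k. k \<ge> N' \<Longrightarrow> norm (\<delta> (\<phi> k) - 0) < e / 3"
      using LIMSEQ_D[of "\<lambda>k. \<delta> (\<phi> k)" 0 "e / 3"] e by auto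
    have "norm ((SUP x\<in>\<Omega>. \<bar>f (\<phi> k) x - u x\<bar>) - 0) < e" if k: "k \<ge> max N N'" for k
    proof -
      have le: "\<bar>f (\<phi> k) x - u x\<bar> \<le> 2 * e / 3" if x: "x \<in> \<Omega>" for x
      proof -
        have "\<bar>w (\<phi> k) x - u x\<bar> < e / 3"
          using N[of k x] k x closure_subset by auto
        moreover have "\<bar>\<delta> (\<phi> k)\<bar> < e / 3"
          using N'[of k] k by auto
        ultimately show ?thesis
          using w_f[OF x, of "\<phi> k"] by linarith
      qed
      have "(SUP x\<in>\<Omega>. \<bar>f (\<phi> k) x - u x\<bar>) \<le> 2 * e / 3"
        using \<Omega> le by (intro cSUP_least) auto
      moreover have "\<bar>f (\<phi> k) y0 - u y0\<bar> \<le> (SUP x\<in>\<Omega>. \<bar>f (\<phi> k) x - u x\<bar>)"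
        by (rule cSUP_upper[OF y0]) (use le in \<open>auto intro!: bdd_aboveI2[of _ _ "2 * e / 3"]\<close>)
      ultimately show ?thesis using e by simp
    qed
    then show "\<exists>N. \<forall>k\<ge>N. norm ((SUP x\<in>\<Omega>. \<bar>f (\<phi> k) x - u x\<bar>) - 0) < e"
      by blast
  qed
  with \<phi> holder show thesis by (rule that)
qed

section \<open>Least mass and mass ratio\<close>

text \<open>
  If the least mass vanishes, the quotient of reals on the left is \<open>0\<close> by convention. Otherwise the claim
  is that the least mass is at most the greatest one.
\<close>

lemma powr_div_min_mass_le_mass_ratio:
  assumes V: "finite V" "V \<noteq> {}"
  shows "ennreal (\<epsilon> powr p / min_mass V \<nu>) \<le> mass_ratio p \<epsilon> V \<nu>"
proof (cases "min_mass V \<nu> = 0")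
  case False
  have "min_mass V \<nu> \<in> (\<lambda>x. measure \<nu> {x}) ` V"
    unfolding min_mass_def using V by (intro Min_in) auto
  then have pos: "0 < min_mass V \<nu>" and le: "min_mass V \<nu> \<le> max_mass V \<nu>"
    using False V by (auto simp: max_mass_def zero_less_measure_iff intro: Max_ge)
  have "\<epsilon> powr p / min_mass V \<nu> = \<epsilon> powr p * min_mass V \<nu> / (min_mass V \<nu>)\<^sup>2"
    by (simp add: power2_eq_square)
  also have "\<dots> \<le> \<epsilon> powr p * max_mass V \<nu> / (min_mass V \<nu>)\<^sup>2"
    using le by (intro divide_right_mono mult_left_mono) auto
  finally show ?thesis
    using pos le unfolding mass_ratio_def by (subst divide_ennreal) (auto intro: ennreal_leI)
qed simp

text \<open>
  The greatest mass is positive because the masses add up to \<open>1\<close>; a vanishing least mass would therefore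
  make the ratio infinite.
\<close>

lemma min_mass_pos:
  assumes V: "finite V" "V \<noteq> {}" and \<nu>: "prob_space \<nu>" "sets \<nu> = Pow V"
    and \<epsilon>: "0 < \<epsilon>" and "mass_ratio p \<epsilon> V \<nu> < \<infinity>"
  shows "0 < min_mass V \<nu>"
proof -
  interpret prob_space \<nu> by fact
  have "space \<nu> = V"
    using sets_eq_imp_space_eq[of \<nu> "count_space V"] \<nu> by simp
  then have "(\<Sum>x\<in>V. measure \<nu> {x}) = 1"
    using V finite_measure_eq_sum_singleton[of V] prob_space \<nu> by simp
  then have "\<not> (\<forall>x\<in>V. measure \<nu> {x} = 0)"
    using sum.neutral[of V "\<lambda>x. measure \<nu> {x}"] by linarith
  then obtain x where x: "x \<in> V" "measure \<nu> {x} \<noteq> 0"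
    by blast
  have "0 < measure \<nu> {x}"
    using x by (simp add: zero_less_measure_iff)
  also have "\<dots> \<le> max_mass V \<nu>"
    unfolding max_mass_def using V x by (intro Max_ge) auto
  finally have "0 < max_mass V \<nu>" .
  moreover have "min_mass V \<nu> \<in> (\<lambda>x. measure \<nu> {x}) ` V"
    unfolding min_mass_def using V by (intro Min_in) auto
  then have "0 \<le> min_mass V \<nu>" by auto
  moreover have "min_mass V \<nu> \<noteq> 0"
    using assms(6) \<open>0 < max_mass V \<nu>\<close> \<epsilon> by (auto simp: mass_ratio_def ennreal_divide_zero)
  ultimately show ?thesis by simp
qed

section \<open>Compactness for bounded graph energies\<close>

lemma exists_pos_radius:
  fixes \<eta> :: "real \<Rightarrow> real"
  assumes "continuous (at 0 within {0..}) \<eta>" "0 < \<eta> 0"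
  shows "\<exists>c>0. 0 < \<eta> c"
proof -
  obtain d where d: "0 < d" "\<And>x. 0 \<le> x \<Longrightarrow> dist x 0 < d \<Longrightarrow> dist (\<eta> x) (\<eta> 0) < \<eta> 0"
    using assms unfolding continuous_within_eps_delta by (metis atLeast_iff)
  have "dist (\<eta> (d / 2)) (\<eta> 0) < \<eta> 0"
    using d(1) by (intro d(2)) auto
  then show ?thesis
    using d(1) by (intro exI[of _ "d / 2"]) (auto simp: dist_real_def)
qed

text \<open>
  The constants \<open>E\<close> and \<open>M = D * N' powr p\<close> of the nonlocal energy bound are the same for all \<open>n\<close>, whereas the
  scale \<open>h n\<close> and the oscillation \<open>\<delta> n\<close> tend to \<open>0\<close>; the latter because \<open>\<epsilon> n powr p / m n\<close> is at most the mass
  ratio. The estimates hold from some index \<open>n0\<close> on, hence the shift of the subsequence.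
\<close>

theorem bounded_graph_energy_subsequence:
  fixes \<Omega> :: "(real ^ 'd) set" and \<eta> :: "real \<Rightarrow> real"
  assumes \<Omega>: "open \<Omega>" "bounded \<Omega>" "lipschitz_boundary \<Omega>"
    and c: "0 < c" "0 < \<eta> c" and \<eta>: "antimono_on {0..} \<eta>" "\<And>r. 0 \<le> r \<Longrightarrow> 0 \<le> \<eta> r"
    and p: "real CARD('d) < p"
    and \<mu>: "prob_space \<mu>" and tm: "\<And>n. transported_measure \<Omega> \<rho> \<mu> (V n) (\<nu> n) (T n) D"
    and \<epsilon>: "\<And>n. 0 < \<epsilon> n" "\<epsilon> \<longlonglongrightarrow> 0" and K: "4 * K \<le> c" 
    and TK: "\<And>n x. x \<in> \<Omega> \<Longrightarrow> norm (T n x - x) \<le> K * \<epsilon> n"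
    and ratio: "(\<lambda>n. mass_ratio p (\<epsilon> n) (V n) (\<nu> n)) \<longlonglongrightarrow> 0"
    and N: "bounded (range (\<lambda>n. graph_Lp_norm p (V n) (\<nu> n) (v n)))"
    and G: "bounded (range (\<lambda>n. graph_energy \<eta> p (\<epsilon> n) (V n) (\<nu> n) (v n)))"
  shows "\<exists>(\<phi> :: nat \<Rightarrow> nat) u. strict_mono \<phi> \<and>
       u \<in> holder_space (1 - real CARD('d) / p) (closure \<Omega>) \<and>
       (\<lambda>k. SUP x\<in>\<Omega>. \<bar>v (\<phi> k) (T (\<phi> k) x) - u x\<bar>) \<longlonglongrightarrow> 0"
proof -
  define \<gamma> where "\<gamma> = 1 - real CARD('d) / p"
  have p0: "0 < p" using p by (meson le_less_trans of_nat_0_le_iff)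
  have \<gamma>: "0 < \<gamma>" "\<gamma> \<le> 1"
    using p p0 by (auto simp: \<gamma>_def)
  have "space \<mu> = \<Omega>"
    using transported_measure.space_\<mu>[OF tm[of 0]] .
  then have ne: "\<Omega> \<noteq> {}"
    using prob_space.not_empty[OF \<mu>] by simp
  have V: "finite (V n)" "V n \<noteq> {}" "prob_space (\<nu> n)" "sets (\<nu> n) = Pow (V n)" and D: "0 < D" for n
  proof -
    interpret transported_measure \<Omega> \<rho> \<mu> "V n" "\<nu> n" "T n" D by (rule tm)
    show "finite (V n)" "prob_space (\<nu> n)" "sets (\<nu> n) = Pow (V n)" "0 < D"
      using V \<nu> sets_\<nu> D by auto
    show "V n \<noteq> {}" using T_in_V ne by auto
  qed
  obtain N' where N': "\<And>n. graph_Lp_norm p (V n) (\<nu> n) (v n) \<le> N'" "0 < N'"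
    using N unfolding bounded_pos by (auto simp: abs_le_iff)
  obtain G' where G': "\<And>n. graph_energy \<eta> p (\<epsilon> n) (V n) (\<nu> n) (v n) \<le> G'" "0 < G'"
    using G unfolding bounded_pos by (auto simp: abs_le_iff)
  define E where "E = D\<^sup>2 * G' / \<eta> c * (4 / c) powr (p + CARD('d))"
  define A where "A = D * G' / \<eta> c * (4 / c) ^ CARD('d)"
  define m where "m = (\<lambda>n. min_mass (V n) (\<nu> n))"
  define \<delta> where "\<delta> = (\<lambda>n. (A * (\<epsilon> n powr p / m n)) powr (1 / p))"
  define h where "h = (\<lambda>n. c / 4 * \<epsilon> n)"
  define f where "f = (\<lambda>n x. if x \<in> \<Omega> then v n (T n x) else 0)"
  have m0: "0 \<le> m n" for n
  proof -
    have "m n \<in> (\<lambda>x. measure (\<nu> n) {x}) ` V n"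
      unfolding m_def min_mass_def using V by (intro Min_in) auto
    then show ?thesis by auto
  qed
  have "eventually (\<lambda>n. mass_ratio p (\<epsilon> n) (V n) (\<nu> n) < 1) sequentially"
    using ratio by (rule order_tendstoD) simp
  then have ev_m: "eventually (\<lambda>n. 0 < m n) sequentially"
  proof eventually_elim
    case (elim n)
    then have "mass_ratio p (\<epsilon> n) (V n) (\<nu> n) < \<infinity>"
      by (rule less_trans) simp
    then show ?case
      unfolding m_def using V \<epsilon> by (intro min_mass_pos)
  qed
  have "(\<lambda>n. ennreal (\<epsilon> n powr p / m n)) \<longlonglongrightarrow> 0"
    unfolding m_def by (rule tendsto_sandwich[OF _ _ tendsto_const ratio])
      (use V in \<open>auto intro!: always_eventually powr_div_min_mass_le_mass_ratio\<close>)
  then have "(\<lambda>n. \<epsilon> n powr p / m n) \<longlonglongrightarrow> 0"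
    using m0 by (subst (asm) ennreal_tendsto_0_iff) auto
  then have "(\<lambda>n. A * (\<epsilon> n powr p / m n)) \<longlonglongrightarrow> 0"
    by (rule tendsto_mult_right_zero)
  then have \<delta>: "\<delta> \<longlonglongrightarrow> 0"
    unfolding \<delta>_def using p0 m0 D G' c
    by (intro tendsto_zero_powrI[OF _ tendsto_const]) (auto simp: A_def intro!: always_eventually)
  have h: "h \<longlonglongrightarrow> 0"
    unfolding h_def using \<epsilon> by (intro tendsto_mult_right_zero)
  have h\<gamma>: "(\<lambda>n. h n powr \<gamma>) \<longlonglongrightarrow> 0"
    using c \<epsilon> \<gamma> by (intro tendsto_zero_powrI[OF h tendsto_const]) (auto simp: h_def less_imp_le intro!: always_eventually)
  have "eventually (\<lambda>n. h n < 1) sequentially" "eventually (\<lambda>n. \<delta> n < 1) sequentially"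
    using order_tendstoD(2)[OF h] order_tendstoD(2)[OF \<delta>] by auto
  then have "eventually (\<lambda>n. 0 < m n \<and> h n < 1 \<and> \<delta> n < 1) sequentially"
    using ev_m by (simp add: eventually_conj_iff)
  then obtain n0 where n0: "\<And>n. n0 \<le> n \<Longrightarrow> 0 < m n \<and> h n < 1 \<and> \<delta> n < 1"
    by (auto simp: eventually_sequentially)
  have neb: "nonlocal_energy_bound \<Omega> p \<gamma> (h n) E (\<delta> n) (D * N' powr p) (f n)" if n: "n0 \<le> n" for n
    unfolding \<gamma>_def h_def E_def \<delta>_def A_def f_def
  proof (rule transported_measure.transported_energy_bound[OF tm p \<epsilon>(1) TK K c(1) _ \<eta> c(2) G' N'])
    show "c / 4 * \<epsilon> n \<le> 1" "0 < m n"
      using n0[OF n] by (auto simp: h_def)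
    show "m n \<le> measure (\<nu> n) {x}" if "x \<in> V n" for x
      using V that unfolding m_def min_mass_def by (intro Min_le) auto
  qed
  obtain \<delta>\<^sub>0 s where cones: "0 < \<delta>\<^sub>0" "0 < s" "uniform_cone_property \<delta>\<^sub>0 s \<Omega>"
    using lipschitz_boundary_uniform_cone[OF \<Omega>] .
  have M: "0 < D * N' powr p"
    using D N' by simp
  obtain L where L: "0 \<le> L"
    and L1: "\<And>h \<delta> f x y. nonlocal_energy_bound \<Omega> p \<gamma> h E \<delta> (D * N' powr p) f \<Longrightarrow> x \<in> \<Omega> \<Longrightarrow> y \<in> \<Omega> \<Longrightarrow>
       \<bar>f x - f y\<bar> \<le> L * (dist x y powr \<gamma> + h powr \<gamma> + \<delta>)"
    and L2: "\<And>h \<delta> f x. nonlocal_energy_bound \<Omega> p \<gamma> h E \<delta> (D * N' powr p) f \<Longrightarrow> x \<in> \<Omega> \<Longrightarrow> \<bar>f x\<bar> \<le> L * (1 + \<delta>)"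
    using nonlocal_morrey[OF cones(3,1,2) M, of p \<gamma> E] by blast
  obtain \<phi> u where \<phi>: "strict_mono (\<phi> :: nat \<Rightarrow> nat)" and u: "u \<in> holder_space \<gamma> (closure \<Omega>)"
    and lim: "(\<lambda>k. SUP x\<in>\<Omega>. \<bar>f (\<phi> k + n0) x - u x\<bar>) \<longlonglongrightarrow> 0"
  proof (rule quasi_holder_subsequence[OF \<Omega>(2) ne \<gamma> L, of "\<lambda>n. f (n + n0)" "\<lambda>n. L * (h (n + n0) powr \<gamma>
      + \<delta> (n + n0))" "L * 2"])
    show "\<bar>f (n + n0) x - f (n + n0) y\<bar> \<le> L * dist x y powr \<gamma> + L * (h (n + n0) powr \<gamma> + \<delta> (n + n0))"
      if "x \<in> \<Omega>" "y \<in> \<Omega>" for n x y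
      using L1[OF neb that, of "n + n0"] by (simp add: algebra_simps)
    show "\<bar>f (n + n0) x\<bar> \<le> L * 2" if "x \<in> \<Omega>" for n x
    proof -
      have "L * (1 + \<delta> (n + n0)) \<le> L * 2"
        using n0[of "n + n0"] L by (intro mult_left_mono) auto
      then show ?thesis
        using L2[OF neb that, of "n + n0"] by simp
    qed
    have "(\<lambda>n. h n powr \<gamma> + \<delta> n) \<longlonglongrightarrow> 0"
      using tendsto_add[OF h\<gamma> \<delta>] by simp
    then have "(\<lambda>n. L * (h n powr \<gamma> + \<delta> n)) \<longlonglongrightarrow> 0"
      by (rule tendsto_mult_right_zero)
    then show "(\<lambda>n. L * (h (n + n0) powr \<gamma> + \<delta> (n + n0))) \<longlonglongrightarrow> 0"
      by (rule LIMSEQ_ignore_initial_segment)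
  qed
  have "(\<lambda>k. SUP x\<in>\<Omega>. \<bar>v (\<phi> k + n0) (T (\<phi> k + n0) x) - u x\<bar>) = (\<lambda>k. SUP x\<in>\<Omega>. \<bar>f (\<phi> k + n0) x - u x\<bar>)"
    by (auto simp: f_def)
  with lim u \<phi> show ?thesis
    unfolding \<gamma>_def by (intro exI[of _ "\<lambda>k. \<phi> k + n0"] exI[of _ u]) (auto simp: strict_mono_def)
qed

theorem proposition5p19:
  fixes \<Omega> :: "(real ^ 'd) set" and \<eta> :: "real \<Rightarrow> real"
  assumes "open \<Omega>" and "bounded \<Omega>" and "lipschitz_boundary \<Omega>"
    and "\<forall>r\<ge>0. 0 \<le> \<eta> r"
  shows "\<exists>S>0. \<forall>(p :: real) (\<rho> :: real ^ 'd \<Rightarrow> real) (\<mu> :: (real ^ 'd) measure)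
      (V :: nat \<Rightarrow> (real ^ 'd) set) (\<nu> :: nat \<Rightarrow> (real ^ 'd) measure)
      (\<epsilon> :: nat \<Rightarrow> real) (K :: real) (T :: nat \<Rightarrow> real ^ 'd \<Rightarrow> real ^ 'd)
      (v :: nat \<Rightarrow> real ^ 'd \<Rightarrow> real).
    real CARD('d) < p \<longrightarrow>
    continuous_on \<Omega> \<rho> \<longrightarrow>
    \<mu> = density (restrict_space lborel \<Omega>) (\<lambda>x. ennreal (\<rho> x)) \<longrightarrow>
    prob_space \<mu> \<longrightarrow>
    (\<forall>n. finite (V n) \<and> V n \<subseteq> \<Omega>) \<longrightarrow>
    (\<forall>n. sets (\<nu> n) = sets (restrict_space borel (V n)) \<and> prob_space (\<nu> n)) \<longrightarrow>
    (\<forall>n. 0 < \<epsilon> n) \<longrightarrow>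
    \<epsilon> \<longlonglongrightarrow> 0 \<longrightarrow>
    0 < K \<and> K \<le> S \<longrightarrow>
    (\<forall>n. T n \<in> restrict_space borel \<Omega> \<rightarrow>\<^sub>M restrict_space borel (V n) \<and>
         distr \<mu> (\<nu> n) (T n) = \<nu> n \<and>
         (SUP x\<in>\<Omega>. norm (T n x - x)) \<le> K * \<epsilon> n) \<longrightarrow>
    continuous (at 0 within {0..}) \<eta> \<and> antimono_on {0..} \<eta> \<and> 0 < \<eta> 0 \<longrightarrow>
    (\<exists>D>0. \<forall>x\<in>\<Omega>. 1 / D \<le> \<rho> x \<and> \<rho> x \<le> D) \<longrightarrow>
    (\<exists>t>p. kernel_moment CARD('d) \<eta> t < \<infinity>) \<longrightarrow>
    (\<lambda>n. mass_ratio p (\<epsilon> n) (V n) (\<nu> n)) \<longlonglongrightarrow> 0 \<longrightarrow>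
    bounded (range (\<lambda>n. graph_Lp_norm p (V n) (\<nu> n) (v n))) \<longrightarrow>
    bounded (range (\<lambda>n. graph_energy \<eta> p (\<epsilon> n) (V n) (\<nu> n) (v n))) \<longrightarrow>
    (\<exists>(\<phi> :: nat \<Rightarrow> nat) u. strict_mono \<phi> \<and>
       u \<in> holder_space (1 - real CARD('d) / p) (closure \<Omega>) \<and>
       (\<lambda>k. SUP x\<in>\<Omega>. \<bar>v (\<phi> k) (T (\<phi> k) x) - u x\<bar>) \<longlonglongrightarrow> 0)"
proof (cases "\<exists>c>0. 0 < \<eta> c")
  case False
  \<comment> \<open>No such kernel satisfies the hypotheses, so any \<open>S\<close> will do.\<close>
  then have "\<not> (continuous (at 0 within {0..}) \<eta> \<and> antimono_on {0..} \<eta> \<and> 0 < \<eta> 0)"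
    using exists_pos_radius by blast
  then show ?thesis
    by (intro exI[of _ 1]) auto
next
  case True
  then obtain c where c: "0 < c" "0 < \<eta> c" by auto
  show ?thesis
  proof (intro exI[of _ "c / 4"] conjI allI impI)
    show "0 < c / 4" using c by simp
  next
    fix p :: real and \<rho> :: "real ^ 'd \<Rightarrow> real" and \<mu> :: "(real ^ 'd) measure"
      and V :: "nat \<Rightarrow> (real ^ 'd) set" and \<nu> :: "nat \<Rightarrow> (real ^ 'd) measure"
      and \<epsilon> :: "nat \<Rightarrow> real" and K :: real and T :: "nat \<Rightarrow> real ^ 'd \<Rightarrow> real ^ 'd"
      and v :: "nat \<Rightarrow> real ^ 'd \<Rightarrow> real"
    assume p: "real CARD('d) < p" and \<rho>: "continuous_on \<Omega> \<rho>"
      and \<mu>: "\<mu> = density (restrict_space lborel \<Omega>) (\<lambda>x. ennreal (\<rho> x))" "prob_space \<mu>"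
      and V: "\<forall>n. finite (V n) \<and> V n \<subseteq> \<Omega>"
      and \<nu>: "\<forall>n. sets (\<nu> n) = sets (restrict_space borel (V n)) \<and> prob_space (\<nu> n)"
      and \<epsilon>: "\<forall>n. 0 < \<epsilon> n" "\<epsilon> \<longlonglongrightarrow> 0" and K: "0 < K \<and> K \<le> c / 4"
      and T: "\<forall>n. T n \<in> restrict_space borel \<Omega> \<rightarrow>\<^sub>M restrict_space borel (V n) \<and>
         distr \<mu> (\<nu> n) (T n) = \<nu> n \<and> (SUP x\<in>\<Omega>. norm (T n x - x)) \<le> K * \<epsilon> n"
      and \<eta>: "continuous (at 0 within {0..}) \<eta> \<and> antimono_on {0..} \<eta> \<and> 0 < \<eta> 0"
      and D: "\<exists>D>0. \<forall>x\<in>\<Omega>. 1 / D \<le> \<rho> x \<and> \<rho> x \<le> D"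
      and bounds: "(\<lambda>n. mass_ratio p (\<epsilon> n) (V n) (\<nu> n)) \<longlonglongrightarrow> 0"
        "bounded (range (\<lambda>n. graph_Lp_norm p (V n) (\<nu> n) (v n)))"
        "bounded (range (\<lambda>n. graph_energy \<eta> p (\<epsilon> n) (V n) (\<nu> n) (v n)))"
    obtain D where D: "0 < D" "\<And>x. x \<in> \<Omega> \<Longrightarrow> 1 / D \<le> \<rho> x"
      using D by auto
    have tm: "transported_measure \<Omega> \<rho> \<mu> (V n) (\<nu> n) (T n) D" for n
      using V \<nu> T by (intro transported_measure.intro assms(1) \<rho> \<mu>(1) D) blast+
    \<comment> \<open>The supremum bounds the displacements because these are bounded, by boundedness of \<open>\<Omega>\<close>.\<close>
    have TK: "norm (T n x - x) \<le> K * \<epsilon> n" if x: "x \<in> \<Omega>" for n x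
    proof -
      obtain B where B: "\<And>x. x \<in> \<Omega> \<Longrightarrow> norm x \<le> B"
        using \<open>bounded \<Omega>\<close> by (auto simp: bounded_iff)
      have "norm (T n y - y) \<le> B + B" if "y \<in> \<Omega>" for y
      proof -
        have "T n y \<in> \<Omega>"
          using transported_measure.T_in_V[OF tm that] V by blast
        then show ?thesis
          using B[OF that] B[of "T n y"] norm_triangle_ineq4[of "T n y" y] by linarith
      qed
      then have "norm (T n x - x) \<le> (SUP x\<in>\<Omega>. norm (T n x - x))"
        using x by (intro cSUP_upper) (auto intro!: bdd_aboveI2[of _ _ "B + B"])
      then show ?thesis
        using T by (meson order_trans)
    qed
    show "\<exists>(\<phi> :: nat \<Rightarrow> nat) u. strict_mono \<phi> \<and>
       u \<in> holder_space (1 - real CARD('d) / p) (closure \<Omega>) \<and>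
       (\<lambda>k. SUP x\<in>\<Omega>. \<bar>v (\<phi> k) (T (\<phi> k) x) - u x\<bar>) \<longlonglongrightarrow> 0"
    proof (rule bounded_graph_energy_subsequence[of \<Omega> c \<eta> p \<mu> \<rho> V \<nu> T D \<epsilon> K v,
        OF assms(1-3) c _ _ p \<mu>(2) tm _ \<epsilon>(2) _ TK bounds])
      show "antimono_on {0..} \<eta>" "4 * K \<le> c" using \<eta> K by auto
      show "0 \<le> \<eta> r" if "0 \<le> r" for r using assms(4) that by blast
      show "0 < \<epsilon> n" for n using \<epsilon>(1) by blast
    qed
  qed
qed

end
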